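(* Let $E$ and $W$ be nonzero finite-rank free abelian groups, let $\mu:E\otimes E\otimes E\to W$ be a surjective homomorphism (trilinear map), and let $T_\mu=E\oplus W$ be the associated two-step tensor system, with $P,\Theta_\mu,B_\mu,Q_\mu,\overline m_\mu$ as defined in the context. There is an isomorphism of abelian groups $\mathcal O(T_\mu,\mathbb Z)\cong P\oplus Q_\mu$ under which multiplication is $$(p,q)(p',q')=(0,\overline m_\mu(p,p')).$$ Consequently, $\mathcal O(T_\mu,\mathbb Z)^2\subseteq Q_\mu$ and $\mathcal O(T_\mu,\mathbb Z)^3=0$. The regular representation is $\Theta_\mu$ on $P$ and zero on $Q_\mu$. Hence $$\mathfrak D(T_\mu,\mathbb Z)\cong\ker\Theta_\mu\oplus Q_\mu.$$ Furthermore, $\mathfrak K(T_\mu,\mathbb Z)=\mathfrak D(T_\mu,\mathbb Z)$, $\mathfrak K(T_\mu,\mathbb Z)^2=0$, and $$\mathcal R_{T_\mu}\cong\mathbb Z\ltimes\operatorname{im}\Theta_\mu$$ with square-zero ideal $\operatorname{im}\Theta_\mu$.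
   Context: The two-step tensor system $T_\mu=E\oplus W$ has $\Gamma=\mathbb Z$ and ternary product $(x+u)\,n\,(y+v)\,m\,(z+w)=nm\,\mu(x,y,z)$ for $x,y,z\in E$, $u,v,w\in W$, $n,m\in\mathbb Z$; it is an additive ternary $\mathbb Z$-ring (i.e. the operation $x\alpha y\beta z$ is additive in all five variables and $(x\alpha y\beta z)\gamma u\delta v=x\alpha(y\beta z\gamma u)\delta v=x\alpha y\beta(z\gamma u\delta v)$). Here $\mu(x,y,z)=\mu(x\otimes y\otimes z)$. Put $P=E\otimes E$, $L=W\otimes E$, $R=E\otimes W$. Define $\Theta_\mu:P\to\operatorname{Hom}_{\mathbb Z}(E,W)$ by $\Theta_\mu(a\otimes b)(c)=\mu(a,b,c)$; $B_\mu:E^{\otimes4}\to L\oplus R$ by $B_\mu(a\otimes b\otimes c\otimes d)=\mu(a,b,c)\otimes d-a\otimes\mu(b,c,d)$; $Q_\mu=\operatorname{coker}B_\mu$; and the bilinear map $\overline m_\mu:P\times P\to Q_\mu$ by $\overline m_\mu(a\otimes b,c\otimes d)=$ the class of $\mu(a,b,c)\otimes d$. For an additive ternary $\Gamma$-ring $T$: $F(T,\Gamma)=T\otimes_{\mathbb Z}\Gamma\otimes_{\mathbb Z}T\otimes_{\mathbb Z}\Gamma$ carries the associative multiplication $(a\otimes\alpha\otimes b\otimes\beta)(c\otimes\gamma\otimes d\otimes\delta)=(a\alpha b\beta c)\otimes\gamma\otimes d\otimes\delta$; $\mathcal O(T,\Gamma)$ is its quotient by the two-sided ideal generated by all $(a\alpha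 b\beta c)\otimes\gamma\otimes d\otimes\delta-a\otimes\alpha\otimes(b\beta c\gamma d)\otimes\delta$; $[a,\alpha,b,\beta]$ is the class of a pure tensor; $\mathcal A(T,\Gamma)=\mathbb Z\oplus\mathcal O(T,\Gamma)$ with $(n,r)(m,s)=(nm,ns+mr+rs)$. The regular representation is $\rho_T:\mathcal O(T,\Gamma)\to\operatorname{End}_{\mathbb Z}(T)$, $\rho_T([a,\alpha,b,\beta])(x)=a\alpha b\beta x$, and $\widehat\rho_T:\mathcal A(T,\Gamma)\to\operatorname{End}_{\mathbb Z}(T)$, $\widehat\rho_T(n,u)=n\operatorname{id}_T+\rho_T(u)$. Then $\mathfrak D(T,\Gamma)=\ker\rho_T$ (intrinsic defect), $\mathfrak K(T,\Gamma)=\ker\widehat\rho_T$ (unital regular defect), $\mathcal R_T=\operatorname{im}\widehat\rho_T$ (regular operator ring). $\mathfrak D$ is viewed inside $\mathcal A$ via $u\mapsto(0,u)$. An element $\phi\in\operatorname{Hom}_{\mathbb Z}(E,W)$ is regarded as the endomorphism $c+u\mapsto\phi(c)$ of $T_\mu=E\oplus W$. $\mathbb Z\ltimes I$ denotes $\mathbb Z\oplus I$ with $(n,r)(m,s)=(nm,ns+mr+rs)$. *)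

theory Defs
  imports
    Complex_Main
    "HOL-Algebra.Free_Abelian_Groups"
    "HOL-Algebra.QuotRing"
    "HOL-Algebra.Ideal_Product"
    "HOL-Library.Product_Plus"
begin

text \<open>
  The abelian groups that are given or built by tensor products are types of class
  \<^class>\<open>ab_group_add\<close>. Quotients depending on a parameter (the ring \<open>\<O>(T,\<Gamma>)\<close>, the cokernel
  \<open>Q\<^sub>\<mu>\<close>) and subrings are records of HOL-Algebra over these types.
\<close>

subsection \<open>Abelian groups\<close>

definition additive_group :: "'a::ab_group_add monoid"
  where "additive_group = \<lparr>carrier = UNIV, mult = (+), one = 0\<rparr>"

definition zmul :: "int \<Rightarrow> 'a::ab_group_add \<Rightarrow> 'a"
  where "zmul n x = x [^]\<^bsub>additive_group\<^esub> n"

definition free_finite_rank :: "'a::ab_group_add itself \<Rightarrow> bool"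
  where "free_finite_rank _ \<longleftrightarrow>
    (\<exists>n. (additive_group :: 'a monoid) \<cong> free_Abelian_group {..<n::nat})"

lemma additive_group_simps [simp]:
  "carrier additive_group = UNIV" "x \<otimes>\<^bsub>additive_group\<^esub> y = x + y" "\<one>\<^bsub>additive_group\<^esub> = 0"
  by (simp_all add: additive_group_def)

lemma comm_group_additive_group: "comm_group (additive_group :: 'a::ab_group_add monoid)"
  by (rule comm_groupI) (auto simp: algebra_simps intro: exI[of _ "- x" for x])

lemma zmul_0 [simp]: "zmul 0 x = (0 :: 'a::ab_group_add)"
  and zmul_1 [simp]: "zmul 1 x = (x :: 'a)"
  and zmul_zero_right [simp]: "zmul n 0 = (0 :: 'a)"
  and zmul_add_left: "zmul (m + n) x = zmul m x + zmul n (x :: 'a)"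
  and zmul_add_right: "zmul n (x + y) = zmul n x + zmul n (y :: 'a)"
  and zmul_mult: "zmul m (zmul n x) = zmul (m * n) (x :: 'a)"
proof -
  interpret comm_group "additive_group :: 'a monoid" by (rule comm_group_additive_group)
  show "zmul 0 x = 0" "zmul 1 x = x" "zmul n 0 = (0 :: 'a)" for x :: 'a
    using int_pow_1[of x] int_pow_one[of n] by (simp_all add: zmul_def)
  show "zmul (m + n) x = zmul m x + zmul n x" for x :: 'a
    using int_pow_mult[of x m n] by (simp add: zmul_def)
  show "zmul n (x + y) = zmul n x + zmul n y" for x y :: 'a
    using int_pow_distrib[of x y n] by (simp add: zmul_def)
  show "zmul m (zmul n x) = zmul (m * n) x" for x :: 'a
    using int_pow_pow[of x n m] by (simp add: zmul_def mult.commute)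
qed


subsection \<open>Tensor products over the integers\<close>

definition tensor_relators :: "('a::ab_group_add \<times> 'b::ab_group_add \<Rightarrow>\<^sub>0 int) set"
  where "tensor_relators =
    {frag_of (a + a', b) - frag_of (a, b) - frag_of (a', b) | a a' b. True} \<union>
    {frag_of (a, b + b') - frag_of (a, b) - frag_of (a, b') | a b b'. True}"

definition tensor_null :: "('a::ab_group_add \<times> 'b::ab_group_add \<Rightarrow>\<^sub>0 int) set"
  where "tensor_null = generate (free_Abelian_group UNIV) tensor_relators"

lemma tensor_null_0: "0 \<in> tensor_null"
  using generate.one[of "free_Abelian_group UNIV"] by (simp add: tensor_null_def)

lemma tensor_null_add: "x \<in> tensor_null \<Longrightarrow> y \<in> tensor_null \<Longrightarrow> x + y \<in> tensor_null"
  using generate.eng[of _ "free_Abelian_group UNIV"] by (fastforce simp: tensor_null_def)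

lemma tensor_null_uminus: "x \<in> tensor_null \<Longrightarrow> - x \<in> tensor_null"
  using group.generate_m_inv_closed[of "free_Abelian_group UNIV" tensor_relators x]
  by (simp add: tensor_null_def subset_iff)

definition tensor_eq :: "('a::ab_group_add \<times> 'b::ab_group_add \<Rightarrow>\<^sub>0 int) \<Rightarrow> ('a \<times> 'b \<Rightarrow>\<^sub>0 int) \<Rightarrow> bool"
  where "tensor_eq x y \<longleftrightarrow> x - y \<in> tensor_null"

quotient_type (overloaded) ('a, 'b) tensor =
    "'a::ab_group_add \<times> 'b::ab_group_add \<Rightarrow>\<^sub>0 int" / tensor_eq
proof (rule equivpI)
  show "reflp (tensor_eq :: ('a \<times> 'b \<Rightarrow>\<^sub>0 int) \<Rightarrow> _)"
    by (simp add: reflp_def tensor_eq_def tensor_null_0)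
  show "symp (tensor_eq :: ('a \<times> 'b \<Rightarrow>\<^sub>0 int) \<Rightarrow> _)"
    using tensor_null_uminus by (fastforce simp: symp_def tensor_eq_def)
  show "transp (tensor_eq :: ('a \<times> 'b \<Rightarrow>\<^sub>0 int) \<Rightarrow> _)"
    using tensor_null_add by (fastforce simp: transp_def tensor_eq_def)
qed

instantiation tensor :: (ab_group_add, ab_group_add) ab_group_add
begin

lift_definition zero_tensor :: "('a, 'b) tensor" is 0 .

lift_definition plus_tensor :: "('a, 'b) tensor \<Rightarrow> ('a, 'b) tensor \<Rightarrow> ('a, 'b) tensor" is "(+)"
proof -
  fix x x' y y' :: "'a \<times> 'b \<Rightarrow>\<^sub>0 int"
  assume "tensor_eq x x'" "tensor_eq y y'"
  then have "(x - x') + (y - y') \<in> tensor_null"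
    unfolding tensor_eq_def by (rule tensor_null_add)
  then show "tensor_eq (x + y) (x' + y')" by (simp add: tensor_eq_def algebra_simps)
qed

lift_definition uminus_tensor :: "('a, 'b) tensor \<Rightarrow> ('a, 'b) tensor" is uminus
  using tensor_null_uminus by (fastforce simp: tensor_eq_def)

definition minus_tensor :: "('a, 'b) tensor \<Rightarrow> ('a, 'b) tensor \<Rightarrow> ('a, 'b) tensor"
  where "minus_tensor x y = x + - y"

instance
  by standard
    (simp_all add: minus_tensor_def, (transfer, simp add: tensor_eq_def algebra_simps tensor_null_0)+)

end

lift_definition tensor_pure :: "'a::ab_group_add \<Rightarrow> 'b::ab_group_add \<Rightarrow> ('a, 'b) tensor"
    (infixl "\<otimes>\<^sub>\<int>" 75)
  is "\<lambda>a b. frag_of (a, b)" .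

lemma tensor_pure_add_left: "(a + a') \<otimes>\<^sub>\<int> b = a \<otimes>\<^sub>\<int> b + a' \<otimes>\<^sub>\<int> b"
proof (transfer, unfold tensor_eq_def tensor_null_def, rule generate.incl)
  fix a a' :: 'a and b :: 'b
  show "frag_of (a + a', b) - (frag_of (a, b) + frag_of (a', b)) \<in> tensor_relators"
    unfolding tensor_relators_def diff_diff_eq by blast
qed

lemma tensor_pure_add_right: "a \<otimes>\<^sub>\<int> (b + b') = a \<otimes>\<^sub>\<int> b + a \<otimes>\<^sub>\<int> b'"
proof (transfer, unfold tensor_eq_def tensor_null_def, rule generate.incl)
  fix a :: 'a and b b' :: 'b
  show "frag_of (a, b + b') - (frag_of (a, b) + frag_of (a, b')) \<in> tensor_relators"
    unfolding tensor_relators_def diff_diff_eq by blast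
qed

lemma tensor_induct [case_names pure diff]:
  fixes t :: "('a::ab_group_add, 'b::ab_group_add) tensor"
  assumes pure: "\<And>a b. P (a \<otimes>\<^sub>\<int> b)" and diff: "\<And>x y. P x \<Longrightarrow> P y \<Longrightarrow> P (x - y)"
  shows "P t"
proof -
  have zero: "P 0" using diff[OF pure pure, of 0 0 0 0] by simp
  have "P (abs_tensor x)" for x
  proof (rule free_Abelian_group_induct[of x UNIV])
    show "P (abs_tensor 0)" using zero by (simp add: zero_tensor_def)
    show "P (abs_tensor (x - y))" if "P (abs_tensor x)" "P (abs_tensor y)" for x y
      using diff[OF that]
      by (simp add: minus_tensor_def plus_tensor.abs_eq uminus_tensor.abs_eq)
    show "P (abs_tensor (frag_of c))" for c
      using pure[of "fst c" "snd c"] by (simp add: tensor_pure.abs_eq)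
  qed simp
  then show ?thesis by (induct t rule: tensor.abs_induct) simp
qed

lemma additive_zero: "additive f \<Longrightarrow> f 0 = 0"
  by (rule additive.zero)

lemma additive_comp: "additive f \<Longrightarrow> additive g \<Longrightarrow> additive (\<lambda>x. f (g x))"
  by (simp add: additive_def)

lemma tensor_hom_eqI:
  assumes "additive f" "additive g" "\<And>a b. f (a \<otimes>\<^sub>\<int> b) = g (a \<otimes>\<^sub>\<int> b)"
  shows "f t = g t"
  using assms by (induction t rule: tensor_induct) (auto simp: additive.diff)

definition biadditive ::
    "('a::ab_group_add \<Rightarrow> 'b::ab_group_add \<Rightarrow> 'c::ab_group_add) \<Rightarrow> bool"
  where "biadditive f \<longleftrightarrow> (\<forall>b. additive (\<lambda>a. f a b)) \<and> (\<forall>a. additive (f a))"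

lemma biadditiveD:
  assumes "biadditive f"
  shows "f (a + a') b = f a b + f a' b" "f a (b + b') = f a b + f a b'"
  using assms by (auto simp: biadditive_def additive_def)

lemma tensor_hom_ex:
  fixes f :: "'a::ab_group_add \<Rightarrow> 'b::ab_group_add \<Rightarrow> 'c::ab_group_add"
  assumes f: "biadditive f"
  shows "\<exists>h. additive h \<and> (\<forall>a b. h (a \<otimes>\<^sub>\<int> b) = f a b)"
proof -
  let ?F = "free_Abelian_group (UNIV :: ('a \<times> 'b) set)"
  interpret C: comm_group "additive_group :: 'c monoid" by (rule comm_group_additive_group)
  obtain h where h: "h \<in> hom ?F additive_group" and hf: "\<And>x. h (frag_of x) = f (fst x) (snd x)"
    using C.free_Abelian_group_universal[of "\<lambda>x. f (fst x) (snd x)" UNIV] by auto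
  have h_add: "additive h"
    using h by (simp add: additive_def hom_def free_Abelian_group_def)
  have h_rel: "h x = 0" if "x \<in> tensor_relators" for x
    using that by (auto simp: tensor_relators_def additive.diff[OF h_add] hf biadditiveD[OF f])
  have h_null: "h x = 0" if "x \<in> tensor_null" for x
    using that unfolding tensor_null_def
  proof (induction rule: generate.induct)
    case one
    then show ?case using additive_zero[OF h_add] by simp
  next
    case (incl x)
    then show ?case by (rule h_rel)
  next
    case (inv x)
    then show ?case by (simp add: h_rel additive.minus[OF h_add])
  next
    case (eng x y)
    then show ?case by (simp add: additive.add[OF h_add])
  qed
  have h_rep: "h (rep_tensor (abs_tensor x)) = h x" for x
  proof -
    have "tensor_eq (rep_tensor (abs_tensor x)) x"
      by (simp add: tensor.abs_eq_iff[symmetric] Quotient3_abs_rep[OF Quotient3_tensor])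
    then show ?thesis
      using h_null[of "rep_tensor (abs_tensor x) - x"]
      by (simp add: tensor_eq_def additive.diff[OF h_add])
  qed
  have "additive (\<lambda>t. h (rep_tensor t))"
  proof
    fix s t :: "('a, 'b) tensor"
    obtain x where "s = abs_tensor x" by (induct s rule: tensor.abs_induct) blast
    moreover obtain y where "t = abs_tensor y" by (induct t rule: tensor.abs_induct) blast
    ultimately show "h (rep_tensor (s + t)) = h (rep_tensor s) + h (rep_tensor t)"
      by (simp add: plus_tensor.abs_eq h_rep additive.add[OF h_add])
  qed
  moreover have "h (rep_tensor (a \<otimes>\<^sub>\<int> b)) = f a b" for a b
    by (simp add: tensor_pure.abs_eq h_rep hf)
  ultimately show ?thesis by blast
qed

text \<open>
  The homomorphism induced by a biadditive (respectively, additive in four variables) map. The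
  description is meaningful only for such maps.
\<close>

definition tensor_lift ::
    "('a::ab_group_add \<Rightarrow> 'b::ab_group_add \<Rightarrow> 'c::ab_group_add) \<Rightarrow> ('a, 'b) tensor \<Rightarrow> 'c"
  where "tensor_lift f = (THE h. additive h \<and> (\<forall>a b. h (a \<otimes>\<^sub>\<int> b) = f a b))"

lemma
  assumes "biadditive f"
  shows additive_tensor_lift: "additive (tensor_lift f)"
    and tensor_lift_pure: "tensor_lift f (a \<otimes>\<^sub>\<int> b) = f a b"
proof -
  have "\<exists>!h. additive h \<and> (\<forall>a b. h (a \<otimes>\<^sub>\<int> b) = f a b)"
  proof (rule ex_ex1I[OF tensor_hom_ex[OF assms]])
    fix g h assume "additive g \<and> (\<forall>a b. g (a \<otimes>\<^sub>\<int> b) = f a b)"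
      and "additive h \<and> (\<forall>a b. h (a \<otimes>\<^sub>\<int> b) = f a b)"
    then show "g = h" by (intro ext) (rule tensor_hom_eqI, simp_all)
  qed
  from theI'[OF this] show "additive (tensor_lift f)" "tensor_lift f (a \<otimes>\<^sub>\<int> b) = f a b"
    by (simp_all add: tensor_lift_def)
qed

definition tensor_lift4 ::
    "('a::ab_group_add \<Rightarrow> 'b::ab_group_add \<Rightarrow> 'c::ab_group_add \<Rightarrow> 'd::ab_group_add \<Rightarrow> 'x::ab_group_add)
      \<Rightarrow> ((('a, 'b) tensor, 'c) tensor, 'd) tensor \<Rightarrow> 'x"
  where "tensor_lift4 f =
    (THE h. additive h \<and> (\<forall>a b c d. h (a \<otimes>\<^sub>\<int> b \<otimes>\<^sub>\<int> c \<otimes>\<^sub>\<int> d) = f a b c d))"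

definition quadadditive ::
    "('a::ab_group_add \<Rightarrow> 'b::ab_group_add \<Rightarrow> 'c::ab_group_add \<Rightarrow> 'd::ab_group_add \<Rightarrow> 'x::ab_group_add) \<Rightarrow> bool"
  where "quadadditive f \<longleftrightarrow>
    (\<forall>b c d. additive (\<lambda>a. f a b c d)) \<and> (\<forall>a c d. additive (\<lambda>b. f a b c d)) \<and>
    (\<forall>a b d. additive (\<lambda>c. f a b c d)) \<and> (\<forall>a b c. additive (\<lambda>d. f a b c d))"

lemma additive_pure_left: "additive (\<lambda>a. a \<otimes>\<^sub>\<int> b)"
  and additive_pure_right: "additive (\<lambda>b. a \<otimes>\<^sub>\<int> b)"
  by (simp_all add: additive_def tensor_pure_add_left tensor_pure_add_right)

lemma tensor_lift_additive_param:
  assumes "\<And>c. biadditive (f c)" "\<And>a b. additive (\<lambda>c. f c a b)"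
  shows "additive (\<lambda>c. tensor_lift (f c) t)"
proof
  fix c d
  have *: "additive (\<lambda>t. tensor_lift (f c) t + tensor_lift (f d) t)"
    using additive_tensor_lift[OF assms(1), of c] additive_tensor_lift[OF assms(1), of d]
    by (simp add: additive_def algebra_simps)
  show "tensor_lift (f (c + d)) t = tensor_lift (f c) t + tensor_lift (f d) t"
    by (rule tensor_hom_eqI[OF additive_tensor_lift[OF assms(1)] *])
      (simp add: tensor_lift_pure[OF assms(1)] additive.add[OF assms(2)])
qed

lemma tensor4_hom_eqI:
  assumes "additive f" "additive g"
    and "\<And>a b c d. f (a \<otimes>\<^sub>\<int> b \<otimes>\<^sub>\<int> c \<otimes>\<^sub>\<int> d) = g (a \<otimes>\<^sub>\<int> b \<otimes>\<^sub>\<int> c \<otimes>\<^sub>\<int> d)"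
  shows "f t = g t"
proof (rule tensor_hom_eqI[OF assms(1,2)])
  note simps = additive_def tensor_pure_add_left additive.add[OF assms(1)] additive.add[OF assms(2)]
  fix t3 d
  show "f (t3 \<otimes>\<^sub>\<int> d) = g (t3 \<otimes>\<^sub>\<int> d)"
  proof (rule tensor_hom_eqI[of "\<lambda>t3. f (t3 \<otimes>\<^sub>\<int> d)" "\<lambda>t3. g (t3 \<otimes>\<^sub>\<int> d)"])
    fix t2 c
    show "f (t2 \<otimes>\<^sub>\<int> c \<otimes>\<^sub>\<int> d) = g (t2 \<otimes>\<^sub>\<int> c \<otimes>\<^sub>\<int> d)"
      by (rule tensor_hom_eqI[of "\<lambda>t2. f (t2 \<otimes>\<^sub>\<int> c \<otimes>\<^sub>\<int> d)" "\<lambda>t2. g (t2 \<otimes>\<^sub>\<int> c \<otimes>\<^sub>\<int> d)"])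
        (simp_all add: simps assms(3))
  qed (simp_all add: simps)
qed

lemma
  assumes f: "quadadditive f"
  shows additive_tensor_lift4: "additive (tensor_lift4 f)"
    and tensor_lift4_pure: "tensor_lift4 f (a \<otimes>\<^sub>\<int> b \<otimes>\<^sub>\<int> c \<otimes>\<^sub>\<int> d) = f a b c d"
proof -
  define f2 where "f2 c d = tensor_lift (\<lambda>a b. f a b c d)" for c d
  define f3 where "f3 d = tensor_lift (\<lambda>t c. f2 c d t)" for d
  have 2: "biadditive (\<lambda>a b. f a b c d)" for c d
    using f by (simp add: quadadditive_def biadditive_def)
  have add: "additive (\<lambda>c. f2 c d t)" "additive (\<lambda>d. f2 c d t)" for c d t
    unfolding f2_def using f by (auto simp: quadadditive_def intro: tensor_lift_additive_param 2)
  have 3: "biadditive (\<lambda>t c. f2 c d t)" for d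
    using add additive_tensor_lift[OF 2] by (simp add: biadditive_def f2_def)
  have "additive (\<lambda>d. f3 d t)" for t
    unfolding f3_def using add by (intro tensor_lift_additive_param 3)
  then have 4: "biadditive (\<lambda>t d. f3 d t)"
    using additive_tensor_lift[OF 3] by (simp add: biadditive_def f3_def)
  have "\<exists>!h. additive h \<and> (\<forall>a b c d. h (a \<otimes>\<^sub>\<int> b \<otimes>\<^sub>\<int> c \<otimes>\<^sub>\<int> d) = f a b c d)"
  proof (rule ex_ex1I)
    show "\<exists>h. additive h \<and> (\<forall>a b c d. h (a \<otimes>\<^sub>\<int> b \<otimes>\<^sub>\<int> c \<otimes>\<^sub>\<int> d) = f a b c d)"
      using additive_tensor_lift[OF 4] tensor_lift_pure[OF 2] tensor_lift_pure[OF 3]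
        tensor_lift_pure[OF 4]
      by (intro exI[of _ "tensor_lift (\<lambda>t d. f3 d t)"]) (simp add: f2_def f3_def)
  next
    fix g h assume "additive g \<and> (\<forall>a b c d. g (a \<otimes>\<^sub>\<int> b \<otimes>\<^sub>\<int> c \<otimes>\<^sub>\<int> d) = f a b c d)"
      and "additive h \<and> (\<forall>a b c d. h (a \<otimes>\<^sub>\<int> b \<otimes>\<^sub>\<int> c \<otimes>\<^sub>\<int> d) = f a b c d)"
    then show "g = h" by (intro ext) (rule tensor4_hom_eqI, simp_all)
  qed
  from theI'[OF this] show "additive (tensor_lift4 f)"
    "tensor_lift4 f (a \<otimes>\<^sub>\<int> b \<otimes>\<^sub>\<int> c \<otimes>\<^sub>\<int> d) = f a b c d"
    by (simp_all add: tensor_lift4_def)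
qed

lemma tensor_lift4_additive_param:
  assumes "\<And>x. quadadditive (f x)" "\<And>a b c d. additive (\<lambda>x. f x a b c d)"
  shows "additive (\<lambda>x. tensor_lift4 (f x) t)"
proof
  fix x y
  have *: "additive (\<lambda>t. tensor_lift4 (f x) t + tensor_lift4 (f y) t)"
    using additive_tensor_lift4[OF assms(1), of x] additive_tensor_lift4[OF assms(1), of y]
    by (simp add: additive_def algebra_simps)
  show "tensor_lift4 (f (x + y)) t = tensor_lift4 (f x) t + tensor_lift4 (f y) t"
    by (rule tensor4_hom_eqI[OF additive_tensor_lift4[OF assms(1)] *])
      (simp add: tensor_lift4_pure[OF assms(1)] additive.add[OF assms(2)])
qed


subsection \<open>Rings without unit\<close>

text \<open>
  Rings that need not have a unit are also written as records of type \<^typ>\<open>'a ring\<close>; their field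
  \<open>one\<close> is a dummy that is never used. The ideals of HOL-Algebra presuppose a unital ring, so ideals
  of such rings and the ideal generated by a set are defined separately. The library's
  \<^const>\<open>ideal_prod\<close> (the sums of products) and \<open>Quot\<close> do not refer to the unit and are used as they are.
\<close>

definition rng_ideal :: "'a set \<Rightarrow> ('a, 'm) ring_scheme \<Rightarrow> bool"
  where "rng_ideal I R \<longleftrightarrow> additive_subgroup I R \<and>
    (\<forall>a\<in>I. \<forall>x\<in>carrier R. x \<otimes>\<^bsub>R\<^esub> a \<in> I \<and> a \<otimes>\<^bsub>R\<^esub> x \<in> I)"

definition rng_genideal :: "('a, 'm) ring_scheme \<Rightarrow> 'a set \<Rightarrow> 'a set"
  where "rng_genideal R S = \<Inter>{I. rng_ideal I R \<and> S \<subseteq> I}"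

definition unitization :: "('a, 'm) ring_scheme \<Rightarrow> (int \<times> 'a) ring"
  where "unitization R =
    \<lparr>carrier = UNIV \<times> carrier R,
     mult = (\<lambda>(n, r) (m, s). (n * m, [n] \<cdot>\<^bsub>R\<^esub> s \<oplus>\<^bsub>R\<^esub> [m] \<cdot>\<^bsub>R\<^esub> r \<oplus>\<^bsub>R\<^esub> r \<otimes>\<^bsub>R\<^esub> s)),
     one = (1, \<zero>\<^bsub>R\<^esub>),
     zero = (0, \<zero>\<^bsub>R\<^esub>),
     add = (\<lambda>(n, r) (m, s). (n + m, r \<oplus>\<^bsub>R\<^esub> s))\<rparr>"

definition End_ring :: "('a::ab_group_add \<Rightarrow> 'a) ring"
  where "End_ring =
    \<lparr>carrier = {f. additive f}, mult = (\<circ>), one = id, zero = (\<lambda>_. 0), add = (\<lambda>f g x. f x + g x)\<rparr>"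


subsection \<open>Additive ternary \<open>\<Gamma>\<close>-rings\<close>

locale ternary_gamma_ring =
  fixes tp :: "'t::ab_group_add \<Rightarrow> 'g::ab_group_add \<Rightarrow> 't \<Rightarrow> 'g \<Rightarrow> 't \<Rightarrow> 't"
  assumes additive: "additive (\<lambda>x. tp x \<alpha> y \<beta> z)" "additive (\<lambda>\<alpha>. tp x \<alpha> y \<beta> z)"
      "additive (\<lambda>y. tp x \<alpha> y \<beta> z)" "additive (\<lambda>\<beta>. tp x \<alpha> y \<beta> z)" "additive (\<lambda>z. tp x \<alpha> y \<beta> z)"
    and assoc: "tp (tp x \<alpha> y \<beta> z) \<gamma> u \<delta> v = tp x \<alpha> (tp y \<beta> z \<gamma> u) \<delta> v"
      "tp x \<alpha> (tp y \<beta> z \<gamma> u) \<delta> v = tp x \<alpha> y \<beta> (tp z \<gamma> u \<delta> v)"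

text \<open>
  In the definitions below \<open>tp x \<alpha> y \<beta> z\<close> is the product \<open>x\<alpha>y\<beta>z\<close>. The homomorphism \<open>gamma_act tp f\<close>
  is \<open>x \<mapsto> a\<alpha>b\<beta>x\<close> for \<open>f = a \<otimes> \<alpha> \<otimes> b \<otimes> \<beta>\<close>; it gives both the first factor of the product of \<open>F(T,\<Gamma>)\<close>
  and the regular representation.
\<close>

definition gamma_act ::
    "('t::ab_group_add \<Rightarrow> 'g::ab_group_add \<Rightarrow> 't \<Rightarrow> 'g \<Rightarrow> 't \<Rightarrow> 't)
      \<Rightarrow> ((('t, 'g) tensor, 't) tensor, 'g) tensor \<Rightarrow> 't \<Rightarrow> 't"
  where "gamma_act tp f x = tensor_lift4 (\<lambda>a \<alpha> b \<beta>. tp a \<alpha> b \<beta> x) f"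

definition F_ring ::
    "('t::ab_group_add \<Rightarrow> 'g::ab_group_add \<Rightarrow> 't \<Rightarrow> 'g \<Rightarrow> 't \<Rightarrow> 't)
      \<Rightarrow> ((('t, 'g) tensor, 't) tensor, 'g) tensor ring"
  where "F_ring tp =
    \<lparr>carrier = UNIV,
     mult = (\<lambda>f g. tensor_lift4 (\<lambda>c \<gamma> d \<delta>. gamma_act tp f c \<otimes>\<^sub>\<int> \<gamma> \<otimes>\<^sub>\<int> d \<otimes>\<^sub>\<int> \<delta>) g),
     one = undefined,
     zero = 0,
     add = (+)\<rparr>"

definition O_relators ::
    "('t::ab_group_add \<Rightarrow> 'g::ab_group_add \<Rightarrow> 't \<Rightarrow> 'g \<Rightarrow> 't \<Rightarrow> 't)
      \<Rightarrow> ((('t, 'g) tensor, 't) tensor, 'g) tensor set"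
  where "O_relators tp =
    {tp a \<alpha> b \<beta> c \<otimes>\<^sub>\<int> \<gamma> \<otimes>\<^sub>\<int> d \<otimes>\<^sub>\<int> \<delta> - a \<otimes>\<^sub>\<int> \<alpha> \<otimes>\<^sub>\<int> tp b \<beta> c \<gamma> d \<otimes>\<^sub>\<int> \<delta>
      | a \<alpha> b \<beta> c \<gamma> d \<delta>. True}"

definition O_ring ::
    "('t::ab_group_add \<Rightarrow> 'g::ab_group_add \<Rightarrow> 't \<Rightarrow> 'g \<Rightarrow> 't \<Rightarrow> 't)
      \<Rightarrow> ((('t, 'g) tensor, 't) tensor, 'g) tensor set ring"
  where "O_ring tp = F_ring tp Quot rng_genideal (F_ring tp) (O_relators tp)"

definition A_ring ::
    "('t::ab_group_add \<Rightarrow> 'g::ab_group_add \<Rightarrow> 't \<Rightarrow> 'g \<Rightarrow> 't \<Rightarrow> 't)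
      \<Rightarrow> (int \<times> ((('t, 'g) tensor, 't) tensor, 'g) tensor set) ring"
  where "A_ring tp = unitization (O_ring tp)"

text \<open>
  An element \<open>u\<close> of \<open>\<O>(T,\<Gamma>)\<close> is a coset in \<open>F(T,\<Gamma>)\<close> on which \<open>gamma_act tp\<close> is constant;
  the regular representation takes this constant value.
\<close>

definition regular_rep ::
    "('t::ab_group_add \<Rightarrow> 'g::ab_group_add \<Rightarrow> 't \<Rightarrow> 'g \<Rightarrow> 't \<Rightarrow> 't)
      \<Rightarrow> ((('t, 'g) tensor, 't) tensor, 'g) tensor set \<Rightarrow> 't \<Rightarrow> 't"
  where "regular_rep tp u = the_elem (gamma_act tp ` u)"

definition unital_regular_rep ::
    "('t::ab_group_add \<Rightarrow> 'g::ab_group_add \<Rightarrow> 't \<Rightarrow> 'g \<Rightarrow> 't \<Rightarrow> 't)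
      \<Rightarrow> int \<times> ((('t, 'g) tensor, 't) tensor, 'g) tensor set \<Rightarrow> 't \<Rightarrow> 't"
  where "unital_regular_rep tp = (\<lambda>(n, u) x. zmul n x + regular_rep tp u x)"

definition intrinsic_defect ::
    "('t::ab_group_add \<Rightarrow> 'g::ab_group_add \<Rightarrow> 't \<Rightarrow> 'g \<Rightarrow> 't \<Rightarrow> 't)
      \<Rightarrow> ((('t, 'g) tensor, 't) tensor, 'g) tensor set set"
  where "intrinsic_defect tp = a_kernel (O_ring tp) End_ring (regular_rep tp)"

definition unital_defect ::
    "('t::ab_group_add \<Rightarrow> 'g::ab_group_add \<Rightarrow> 't \<Rightarrow> 'g \<Rightarrow> 't \<Rightarrow> 't)
      \<Rightarrow> (int \<times> ((('t, 'g) tensor, 't) tensor, 'g) tensor set) set"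
  where "unital_defect tp = a_kernel (A_ring tp) End_ring (unital_regular_rep tp)"

definition regular_operator_ring ::
    "('t::ab_group_add \<Rightarrow> 'g::ab_group_add \<Rightarrow> 't \<Rightarrow> 'g \<Rightarrow> 't \<Rightarrow> 't) \<Rightarrow> ('t \<Rightarrow> 't) ring"
  where "regular_operator_ring tp =
    End_ring\<lparr>carrier := unital_regular_rep tp ` carrier (A_ring tp)\<rparr>"

context ternary_gamma_ring
begin

lemma gamma_act_pure: "gamma_act tp (a \<otimes>\<^sub>\<int> \<alpha> \<otimes>\<^sub>\<int> b \<otimes>\<^sub>\<int> \<beta>) x = tp a \<alpha> b \<beta> x"
  by (simp add: gamma_act_def tensor_lift4_pure quadadditive_def additive)

lemma additive_gamma_act: "additive (gamma_act tp f)" "additive (\<lambda>f. gamma_act tp f x)"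
proof -
  have *: "quadadditive (\<lambda>a \<alpha> b \<beta>. tp a \<alpha> b \<beta> x)" for x
    by (simp add: quadadditive_def additive)
  show "additive (gamma_act tp f)"
    unfolding gamma_act_def[abs_def] by (rule tensor_lift4_additive_param[OF * additive(5)])
  show "additive (\<lambda>f. gamma_act tp f x)"
    unfolding gamma_act_def by (rule additive_tensor_lift4[OF *])
qed

lemma F_ring_mult_pure:
  "(a \<otimes>\<^sub>\<int> \<alpha> \<otimes>\<^sub>\<int> b \<otimes>\<^sub>\<int> \<beta>) \<otimes>\<^bsub>F_ring tp\<^esub> (c \<otimes>\<^sub>\<int> \<gamma> \<otimes>\<^sub>\<int> d \<otimes>\<^sub>\<int> \<delta>) = tp a \<alpha> b \<beta> c \<otimes>\<^sub>\<int> \<gamma> \<otimes>\<^sub>\<int> d \<otimes>\<^sub>\<int> \<delta>"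
proof -
  have *: "quadadditive (\<lambda>c (\<gamma> :: 'g) (d :: 't) (\<delta> :: 'g). gamma_act tp f c \<otimes>\<^sub>\<int> \<gamma> \<otimes>\<^sub>\<int> d \<otimes>\<^sub>\<int> \<delta>)" for f
    by (simp add: quadadditive_def additive_def tensor_pure_add_left tensor_pure_add_right
        additive.add[OF additive_gamma_act(1)])
  have "f \<otimes>\<^bsub>F_ring tp\<^esub> (c \<otimes>\<^sub>\<int> \<gamma> \<otimes>\<^sub>\<int> d \<otimes>\<^sub>\<int> \<delta>) = gamma_act tp f c \<otimes>\<^sub>\<int> \<gamma> \<otimes>\<^sub>\<int> d \<otimes>\<^sub>\<int> \<delta>" for f
    by (simp add: F_ring_def tensor_lift4_pure[OF *])
  then show ?thesis by (simp add: gamma_act_pure)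
qed

end


subsection \<open>The two-step tensor system\<close>

definition two_step ::
    "((('e::ab_group_add, 'e) tensor, 'e) tensor \<Rightarrow> 'w::ab_group_add)
      \<Rightarrow> 'e \<times> 'w \<Rightarrow> int \<Rightarrow> 'e \<times> 'w \<Rightarrow> int \<Rightarrow> 'e \<times> 'w \<Rightarrow> 'e \<times> 'w"
  where "two_step \<mu> x n y m z = (0, zmul (n * m) (\<mu> (fst x \<otimes>\<^sub>\<int> fst y \<otimes>\<^sub>\<int> fst z)))"

definition hom_embed :: "('e::ab_group_add \<Rightarrow> 'w::ab_group_add) \<Rightarrow> 'e \<times> 'w \<Rightarrow> 'e \<times> 'w"
  where "hom_embed \<phi> = (\<lambda>(c, u). (0, \<phi> c))"

definition Theta ::
    "((('e::ab_group_add, 'e) tensor, 'e) tensor \<Rightarrow> 'w::ab_group_add) \<Rightarrow> ('e, 'e) tensor \<Rightarrow> 'e \<Rightarrow> 'w"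
  where "Theta \<mu> p c = \<mu> (p \<otimes>\<^sub>\<int> c)"

definition B_map ::
    "((('e::ab_group_add, 'e) tensor, 'e) tensor \<Rightarrow> 'w::ab_group_add)
      \<Rightarrow> ((('e, 'e) tensor, 'e) tensor, 'e) tensor \<Rightarrow> ('w, 'e) tensor \<times> ('e, 'w) tensor"
  where "B_map \<mu> = tensor_lift4
    (\<lambda>a b c d. (\<mu> (a \<otimes>\<^sub>\<int> b \<otimes>\<^sub>\<int> c) \<otimes>\<^sub>\<int> d, - (a \<otimes>\<^sub>\<int> \<mu> (b \<otimes>\<^sub>\<int> c \<otimes>\<^sub>\<int> d))))"

text \<open>\<open>L \<oplus> R\<close> is the product type and \<open>Q_group\<close> is the cokernel of \<open>B_map\<close>, in multiplicative notation.\<close>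

definition Q_group ::
    "((('e::ab_group_add, 'e) tensor, 'e) tensor \<Rightarrow> 'w::ab_group_add)
      \<Rightarrow> (('w, 'e) tensor \<times> ('e, 'w) tensor) set monoid"
  where "Q_group \<mu> = additive_group Mod range (B_map \<mu>)"

definition m_bar ::
    "((('e::ab_group_add, 'e) tensor, 'e) tensor \<Rightarrow> 'w::ab_group_add)
      \<Rightarrow> ('e, 'e) tensor \<Rightarrow> ('e, 'e) tensor \<Rightarrow> (('w, 'e) tensor \<times> ('e, 'w) tensor) set"
  where "m_bar \<mu> p p' =
    range (B_map \<mu>) #>\<^bsub>additive_group\<^esub> (tensor_lift (\<lambda>c d. Theta \<mu> p c \<otimes>\<^sub>\<int> d) p', 0)"

lemma
  assumes "additive \<mu>"
  shows additive_B_map: "additive (B_map \<mu>)"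
    and B_map_pure: "B_map \<mu> (a \<otimes>\<^sub>\<int> b \<otimes>\<^sub>\<int> c \<otimes>\<^sub>\<int> d) =
      (\<mu> (a \<otimes>\<^sub>\<int> b \<otimes>\<^sub>\<int> c) \<otimes>\<^sub>\<int> d, - (a \<otimes>\<^sub>\<int> \<mu> (b \<otimes>\<^sub>\<int> c \<otimes>\<^sub>\<int> d)))"
    and m_bar_pure: "m_bar \<mu> (a \<otimes>\<^sub>\<int> b) (c \<otimes>\<^sub>\<int> d) =
      range (B_map \<mu>) #>\<^bsub>additive_group\<^esub> (\<mu> (a \<otimes>\<^sub>\<int> b \<otimes>\<^sub>\<int> c) \<otimes>\<^sub>\<int> d, 0)"
proof -
  note simps = additive_def tensor_pure_add_left tensor_pure_add_right additive.add[OF assms]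
  have *: "quadadditive
      (\<lambda>a b c d. (\<mu> (a \<otimes>\<^sub>\<int> b \<otimes>\<^sub>\<int> c) \<otimes>\<^sub>\<int> d, - (a \<otimes>\<^sub>\<int> \<mu> (b \<otimes>\<^sub>\<int> c \<otimes>\<^sub>\<int> d))))"
    by (simp add: quadadditive_def simps)
  show "additive (B_map \<mu>)" "B_map \<mu> (a \<otimes>\<^sub>\<int> b \<otimes>\<^sub>\<int> c \<otimes>\<^sub>\<int> d) =
      (\<mu> (a \<otimes>\<^sub>\<int> b \<otimes>\<^sub>\<int> c) \<otimes>\<^sub>\<int> d, - (a \<otimes>\<^sub>\<int> \<mu> (b \<otimes>\<^sub>\<int> c \<otimes>\<^sub>\<int> d)))"
    unfolding B_map_def by (rule additive_tensor_lift4[OF *]) (rule tensor_lift4_pure[OF *])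
  have "biadditive (\<lambda>c d. Theta \<mu> (a \<otimes>\<^sub>\<int> b) c \<otimes>\<^sub>\<int> d)"
    by (simp add: biadditive_def Theta_def simps)
  from tensor_lift_pure[OF this, of c d] show "m_bar \<mu> (a \<otimes>\<^sub>\<int> b) (c \<otimes>\<^sub>\<int> d) =
      range (B_map \<mu>) #>\<^bsub>additive_group\<^esub> (\<mu> (a \<otimes>\<^sub>\<int> b \<otimes>\<^sub>\<int> c) \<otimes>\<^sub>\<int> d, 0)"
    by (simp only: m_bar_def) (simp only: Theta_def)
qed

lemma ternary_gamma_ring_two_step:
  assumes "additive \<mu>"
  shows "ternary_gamma_ring (two_step \<mu>)"
proof -
  have zero: "0 \<otimes>\<^sub>\<int> b = 0" "a \<otimes>\<^sub>\<int> 0 = 0" for a :: "'x::ab_group_add" and b :: "'y::ab_group_add"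
    using tensor_pure_add_left[of 0 0 b] tensor_pure_add_right[of a 0 0] by simp_all
  show ?thesis
    by standard
      (simp_all add: two_step_def tensor_pure_add_left tensor_pure_add_right additive.add[OF assms]
        zmul_add_left zmul_add_right distrib_left distrib_right zero additive_zero[OF assms])
qed

end

theory Submission
  imports Defs
begin

text \<open>
  Since \<open>T\<^sub>\<mu> = E \<oplus> W\<close>, the group \<open>F(T\<^sub>\<mu>,\<int>)\<close> is \<open>T\<^sub>\<mu> \<otimes> T\<^sub>\<mu> = P \<oplus> (L \<oplus> R) \<oplus> (W \<otimes> W)\<close>. The relators with all
  entries in \<open>E\<close> are the values of \<open>B\<^sub>\<mu>\<close>; those with one outer entry in \<open>W\<close> are pure tensors
  \<open>w \<otimes> \<mu>(b,c,d)\<close>, which span \<open>W \<otimes> W\<close> because \<open>\<mu>\<close> is surjective. As \<open>W\<close> is annihilated by the action,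
  \<open>im B\<^sub>\<mu> \<oplus> (W \<otimes> W)\<close> is already an ideal, and the quotient is \<open>P \<oplus> Q\<^sub>\<mu>\<close>. An element \<open>f\<close> acts on \<open>T\<^sub>\<mu>\<close> by
  \<open>\<Theta>\<^sub>\<mu>\<close> of its \<open>P\<close>-component, which gives the product and the kernels. The integer part of
  \<open>n id + \<Theta>\<^sub>\<mu>(p)\<close> can be read off its restriction to \<open>W\<close>, where \<open>\<Theta>\<^sub>\<mu>(p)\<close> vanishes and which is
  torsion-free and nonzero.
\<close>

section \<open>Additive groups and their cosets\<close>

lemma additive_eq_hom: "additive f \<longleftrightarrow> f \<in> hom additive_group additive_group"
  by (simp add: additive_def hom_def)

lemma additive_zmul:
  assumes "additive f"
  shows "f (zmul n x) = zmul n (f x)"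
  using hom_int_pow[of f additive_group additive_group x n] assms
  by (simp add: zmul_def additive_eq_hom comm_group_additive_group comm_group.axioms)

text \<open>\<open>zmul\<close> is a group power, so on the integers it has to be identified with
  multiplication. Both sides are additive in the scalar and agree at 1, so their difference vanishes
  by induction in both directions.\<close>

lemma zmul_int [simp]: "zmul n (m :: int) = n * m"
proof -
  have "additive (\<lambda>k. zmul k m - k * m)"
    by (simp add: additive_def zmul_add_left distrib_right)
  then have *: "zmul (k + l) m - (k + l) * m = (zmul k m - k * m) + (zmul l m - l * m)" for k l
    by (simp add: additive_def)
  have "zmul n m - n * m = 0"
  proof (induction n rule: int_induct[of _ 0])
    case (step1 i)
    then show ?case using *[of i 1] by simp
  next
    case (step2 i)
    then show ?case using *[of "i - 1" 1] by simp
  qed simp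
  then show ?thesis by simp
qed

lemma zmul_Pair [simp]: "zmul n (a, b) = (zmul n a, zmul n b)"
  using additive_zmul[of fst n "(a, b)"] additive_zmul[of snd n "(a, b)"]
  by (simp add: additive_def prod_eq_iff)

lemma zmul_uminus_left: "zmul (- n) x = - zmul n (x :: 'a::ab_group_add)"
  using zmul_add_left[of "- n" n x] by (simp add: eq_neg_iff_add_eq_0)

lemma zmul_tensor_left: "zmul n a \<otimes>\<^sub>\<int> b = zmul n (a \<otimes>\<^sub>\<int> b)"
  and zmul_tensor_right: "a \<otimes>\<^sub>\<int> zmul n b = zmul n (a \<otimes>\<^sub>\<int> b)"
  using additive_zmul[OF additive_pure_left] additive_zmul[OF additive_pure_right] by auto

lemma tensor_zero [simp]:
  fixes a :: "'a::ab_group_add" and b :: "'b::ab_group_add"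
  shows "(0 :: 'a) \<otimes>\<^sub>\<int> b = 0" "a \<otimes>\<^sub>\<int> (0 :: 'b) = 0"
  using additive_zero[OF additive_pure_left] additive_zero[OF additive_pure_right] by auto

text \<open>The isomorphism turns \<open>zmul n\<close> into the scalar multiple
  \<open>frag_cmul n\<close> of a formal integer combination, which for a nonzero combination
  vanishes only if \<open>n = 0\<close>.\<close>

lemma free_finite_rank_torsion_free:
  assumes "free_finite_rank TYPE('a::ab_group_add)" and "zmul n (x :: 'a) = 0" and "x \<noteq> 0"
  shows "n = 0"
proof -
  obtain k :: nat and h where h: "h \<in> iso (additive_group :: 'a monoid) (free_Abelian_group {..<k})"
    using assms(1) by (auto simp: free_finite_rank_def is_iso_def)
  have G: "group (additive_group :: 'a monoid)"
    using comm_group_additive_group by (rule comm_group.axioms)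
  have hom: "h \<in> hom (additive_group :: 'a monoid) (free_Abelian_group {..<k})"
    and inj: "inj h" using h by (auto simp: iso_iff)
  have 0: "h 0 = 0"
    using hom_one[OF hom G] by simp
  \<comment> \<open>The support condition places \<open>h x\<close> in the carrier, where integer
    powers of \<open>free_Abelian_group\<close> are computed by \<open>frag_cmul\<close>.\<close>
  have "Poly_Mapping.keys (h x) \<subseteq> {..<k}"
    using hom by (simp add: hom_def Pi_def free_Abelian_group_def)
  then have "frag_cmul n (h x) = h (zmul n x)"
    using hom_int_pow[OF hom _ G, of x n] by (simp add: zmul_def)
  also have "\<dots> = 0" using assms(2) 0 by simp
  finally show "n = 0" using assms(3) inj_eq[OF inj, of x 0] 0 by simp
qed

lemma inv_additive_group [simp]: "inv\<^bsub>additive_group\<^esub> x = - (x :: 'a::ab_group_add)"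
proof -
  interpret comm_group "additive_group :: 'a monoid" by (rule comm_group_additive_group)
  show ?thesis using inv_equality[of "- x" x] by simp
qed

lemma subgroup_additive_group_iff:
  "subgroup H additive_group \<longleftrightarrow> 0 \<in> H \<and> (\<forall>x\<in>H. \<forall>y\<in>H. x - y \<in> (H :: 'a::ab_group_add set))"
proof
  assume "subgroup H additive_group"
  then show "0 \<in> H \<and> (\<forall>x\<in>H. \<forall>y\<in>H. x - y \<in> H)"
    using subgroup.one_closed[of H additive_group] subgroup.m_inv_closed[of H additive_group]
      subgroup.m_closed[of H additive_group]
    by (auto simp del: add_uminus_conv_diff simp: diff_conv_add_uminus)
next
  assume *: "0 \<in> H \<and> (\<forall>x\<in>H. \<forall>y\<in>H. x - y \<in> H)"
  then have neg: "- x \<in> H" if "x \<in> H" for x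
    using bspec[OF bspec[OF conjunct2[OF *]], of 0 x] that by simp
  moreover have "x + y \<in> H" if "x \<in> H" "y \<in> H" for x y
    using bspec[OF bspec[OF conjunct2[OF *]], of x "- y"] that neg by simp
  ultimately show "subgroup H additive_group"
    using * comm_group.axioms(2)[OF comm_group_additive_group]
    by (intro group.subgroupI) auto
qed

text \<open>Coset calculus in additive notation, instantiated below with im \<open>B_map\<close>,
  with the ideal \<open>J\<close> and with arbitrary ideals of F(T,\<Gamma>).\<close>

locale additive_coset =
  fixes H :: "'a::ab_group_add set"
  assumes subgroup: "subgroup H additive_group"
begin

sublocale comm_group "additive_group :: 'a monoid" by (rule comm_group_additive_group)

lemma zero_mem: "0 \<in> H" and diff_mem: "x \<in> H \<Longrightarrow> y \<in> H \<Longrightarrow> x - y \<in> H"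
  using subgroup by (auto simp: subgroup_additive_group_iff)

lemma uminus_mem: "x \<in> H \<Longrightarrow> - x \<in> H" and add_mem: "x \<in> H \<Longrightarrow> y \<in> H \<Longrightarrow> x + y \<in> H"
  using subgroup.m_inv_closed[OF subgroup] subgroup.m_closed[OF subgroup] by simp_all

lemma mem_coset_iff: "y \<in> H #>\<^bsub>additive_group\<^esub> x \<longleftrightarrow> y - x \<in> H"
  by (auto simp: r_coset_def intro: bexI[of _ "y - x"])

lemma coset_eq_iff: "H #>\<^bsub>additive_group\<^esub> x = H #>\<^bsub>additive_group\<^esub> y \<longleftrightarrow> x - y \<in> H"
proof
  assume "H #>\<^bsub>additive_group\<^esub> x = H #>\<^bsub>additive_group\<^esub> y"
  then show "x - y \<in> H"
    using repr_independenceD[OF subgroup, of x y] by (simp add: mem_coset_iff)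
next
  assume "x - y \<in> H"
  then show "H #>\<^bsub>additive_group\<^esub> x = H #>\<^bsub>additive_group\<^esub> y"
    using repr_independence[of x H y, OF _ _ subgroup] by (simp add: mem_coset_iff)
qed

lemma coset_zero [simp]: "H #>\<^bsub>additive_group\<^esub> 0 = H"
  using coset_mult_one[of H] by simp

lemma coset_eq_self_iff: "H #>\<^bsub>additive_group\<^esub> x = H \<longleftrightarrow> x \<in> H"
  using coset_eq_iff[of x 0] by simp

lemma coset_add:
  "(H #>\<^bsub>additive_group\<^esub> x) <#>\<^bsub>additive_group\<^esub> (H #>\<^bsub>additive_group\<^esub> y) =
    H #>\<^bsub>additive_group\<^esub> (x + y)"
  using normal.rcos_sum[OF subgroup_imp_normal[OF subgroup], of x y] by simp

lemma rcosets_eq: "rcosets\<^bsub>additive_group\<^esub> H = range (\<lambda>x. H #>\<^bsub>additive_group\<^esub> x)"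
  by (auto simp: RCOSETS_def)

text \<open>Maps out of a quotient, such as \<open>regular_rep\<close>, are defined as the unique
  value of a map on a coset; this evaluates them at a representative.\<close>

lemma the_elem_image_coset:
  assumes "\<And>y. y - x \<in> H \<Longrightarrow> g y = g x"
  shows "the_elem (g ` (H #>\<^bsub>additive_group\<^esub> x)) = g x"
proof -
  have "x \<in> H #>\<^bsub>additive_group\<^esub> x" by (simp add: mem_coset_iff zero_mem)
  moreover have "g y = g x" if "y \<in> H #>\<^bsub>additive_group\<^esub> x" for y
    using that by (intro assms) (simp add: mem_coset_iff)
  ultimately have "g ` (H #>\<^bsub>additive_group\<^esub> x) = {g x}" by blast
  then show ?thesis by simp
qed

end

section \<open>Quotients of \<open>F(T,\<Gamma>)\<close>\<close>

context ternary_gamma_ring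
begin

lemma add_monoid_F_ring: "add_monoid (F_ring tp) = additive_group"
  by (simp add: F_ring_def additive_group_def)

text \<open>The left factor enters the product only through its action
  \<open>gamma_act tp f\<close>, which is additive both in \<open>f\<close> and in the
  argument.\<close>

lemma F_ring_mult_pure_right:
  "f \<otimes>\<^bsub>F_ring tp\<^esub> (c \<otimes>\<^sub>\<int> \<gamma> \<otimes>\<^sub>\<int> d \<otimes>\<^sub>\<int> \<delta>) = gamma_act tp f c \<otimes>\<^sub>\<int> \<gamma> \<otimes>\<^sub>\<int> d \<otimes>\<^sub>\<int> \<delta>"
  and additive_F_ring_mult: "additive (\<lambda>g. f \<otimes>\<^bsub>F_ring tp\<^esub> g)" "additive (\<lambda>f. f \<otimes>\<^bsub>F_ring tp\<^esub> g)"
proof -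
  have *: "quadadditive (\<lambda>c (\<gamma> :: 'g) (d :: 't) (\<delta> :: 'g). gamma_act tp f c \<otimes>\<^sub>\<int> \<gamma> \<otimes>\<^sub>\<int> d \<otimes>\<^sub>\<int> \<delta>)" for f
    by (simp add: quadadditive_def additive_def tensor_pure_add_left tensor_pure_add_right
        additive.add[OF additive_gamma_act(1)])
  show "f \<otimes>\<^bsub>F_ring tp\<^esub> (c \<otimes>\<^sub>\<int> \<gamma> \<otimes>\<^sub>\<int> d \<otimes>\<^sub>\<int> \<delta>) = gamma_act tp f c \<otimes>\<^sub>\<int> \<gamma> \<otimes>\<^sub>\<int> d \<otimes>\<^sub>\<int> \<delta>"
    by (simp add: F_ring_def tensor_lift4_pure[OF *])
  show "additive (\<lambda>g. f \<otimes>\<^bsub>F_ring tp\<^esub> g)"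
    using additive_tensor_lift4[OF *] by (simp add: F_ring_def)
  have "additive (\<lambda>f. gamma_act tp f c \<otimes>\<^sub>\<int> \<gamma> \<otimes>\<^sub>\<int> d \<otimes>\<^sub>\<int> \<delta>)" for c d \<gamma> \<delta>
    by (simp add: additive_def tensor_pure_add_left additive.add[OF additive_gamma_act(2)])
  from tensor_lift4_additive_param[OF * this] show "additive (\<lambda>f. f \<otimes>\<^bsub>F_ring tp\<^esub> g)"
    by (simp add: F_ring_def)
qed

lemma rng_ideal_F_ring_iff:
  "rng_ideal I (F_ring tp) \<longleftrightarrow> subgroup I additive_group \<and>
    (\<forall>a\<in>I. \<forall>x. x \<otimes>\<^bsub>F_ring tp\<^esub> a \<in> I \<and> a \<otimes>\<^bsub>F_ring tp\<^esub> x \<in> I)"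
  unfolding rng_ideal_def additive_subgroup_def add_monoid_F_ring by (simp add: F_ring_def)

text \<open>F(T,\<Gamma>) need not be unital, so the operations of \<open>Quot\<close> are computed
  from their definitions on sets of cosets.\<close>

lemma
  assumes "rng_ideal I (F_ring tp)"
  shows carrier_Quot: "carrier (F_ring tp Quot I) = range (\<lambda>f. I #>\<^bsub>additive_group\<^esub> f)"
    and zero_Quot: "\<zero>\<^bsub>F_ring tp Quot I\<^esub> = I"
    and add_Quot: "(I #>\<^bsub>additive_group\<^esub> f) \<oplus>\<^bsub>F_ring tp Quot I\<^esub> (I #>\<^bsub>additive_group\<^esub> g) =
      I #>\<^bsub>additive_group\<^esub> (f + g)"
    and mult_Quot: "(I #>\<^bsub>additive_group\<^esub> f) \<otimes>\<^bsub>F_ring tp Quot I\<^esub> (I #>\<^bsub>additive_group\<^esub> g) =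
      I #>\<^bsub>additive_group\<^esub> (f \<otimes>\<^bsub>F_ring tp\<^esub> g)"
proof -
  interpret I: additive_coset I
    using assms by (intro additive_coset.intro) (simp add: rng_ideal_F_ring_iff)
  show "carrier (F_ring tp Quot I) = range (\<lambda>f. I #>\<^bsub>additive_group\<^esub> f)"
    unfolding FactRing_def A_RCOSETS_def add_monoid_F_ring by (simp add: I.rcosets_eq)
  show "\<zero>\<^bsub>F_ring tp Quot I\<^esub> = I" by (simp add: FactRing_def)
  show "(I #>\<^bsub>additive_group\<^esub> f) \<oplus>\<^bsub>F_ring tp Quot I\<^esub> (I #>\<^bsub>additive_group\<^esub> g) =
      I #>\<^bsub>additive_group\<^esub> (f + g)"
    unfolding FactRing_def set_add_def add_monoid_F_ring by (simp add: I.coset_add)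
  \<comment> \<open>Independence of the representatives: f'g' - fg = (f' - f)g' + f(g' - g), and
    both summands lie in the two-sided ideal.\<close>
  have "I #>\<^bsub>additive_group\<^esub> (f' \<otimes>\<^bsub>F_ring tp\<^esub> g') = I #>\<^bsub>additive_group\<^esub> (f \<otimes>\<^bsub>F_ring tp\<^esub> g)"
    if "f' - f \<in> I" "g' - g \<in> I" for f' g'
  proof -
    have "f' \<otimes>\<^bsub>F_ring tp\<^esub> g' - f \<otimes>\<^bsub>F_ring tp\<^esub> g =
        (f' - f) \<otimes>\<^bsub>F_ring tp\<^esub> g' + f \<otimes>\<^bsub>F_ring tp\<^esub> (g' - g)"
      by (simp add: additive.diff[OF additive_F_ring_mult(1)] additive.diff[OF additive_F_ring_mult(2)])
    then show ?thesis
      using that assms unfolding I.coset_eq_iff rng_ideal_F_ring_iff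
      by (metis I.add_mem)
  qed
  note mult = this
  have mem: "f \<in> I #>\<^bsub>additive_group\<^esub> f" "g \<in> I #>\<^bsub>additive_group\<^esub> g"
    by (simp_all add: I.mem_coset_iff I.zero_mem)
  \<comment> \<open>\<open>rcoset_mult\<close> is a union over all pairs of representatives. All its
    members coincide and the cosets are nonempty, so it collapses to one coset.\<close>
  have "(I #>\<^bsub>additive_group\<^esub> f) \<otimes>\<^bsub>F_ring tp Quot I\<^esub> (I #>\<^bsub>additive_group\<^esub> g) =
      (\<Union>f'\<in>I #>\<^bsub>additive_group\<^esub> f. \<Union>g'\<in>I #>\<^bsub>additive_group\<^esub> g.
        I #>\<^bsub>additive_group\<^esub> (f' \<otimes>\<^bsub>F_ring tp\<^esub> g'))"
    unfolding FactRing_def rcoset_mult_def a_r_coset_def add_monoid_F_ring by simp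
  also have "\<dots> = (\<Union>f'\<in>I #>\<^bsub>additive_group\<^esub> f. \<Union>g'\<in>I #>\<^bsub>additive_group\<^esub> g.
        I #>\<^bsub>additive_group\<^esub> (f \<otimes>\<^bsub>F_ring tp\<^esub> g))"
    by (intro SUP_cong refl mult) (simp_all only: I.mem_coset_iff)
  also have "\<dots> = I #>\<^bsub>additive_group\<^esub> (f \<otimes>\<^bsub>F_ring tp\<^esub> g)"
    using mem by blast
  finally show "(I #>\<^bsub>additive_group\<^esub> f) \<otimes>\<^bsub>F_ring tp Quot I\<^esub> (I #>\<^bsub>additive_group\<^esub> g) =
      I #>\<^bsub>additive_group\<^esub> (f \<otimes>\<^bsub>F_ring tp\<^esub> g)" .
qed

end

section \<open>Adjoining the integers to a ring of endomorphisms\<close>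

text \<open>An abstract form of im \<Theta>: a possibly non-unital ring of additive endomorphisms.
  The assumption \<open>zmul_mem\<close> makes the sum of the integer multiples of the identity and
  \<open>H\<close> direct.\<close>

locale operator_rng =
  fixes H :: "('a::ab_group_add \<Rightarrow> 'a) set"
  assumes additive: "h \<in> H \<Longrightarrow> additive h"
    and zero_mem: "(\<lambda>_. 0) \<in> H"
    and diff_mem: "g \<in> H \<Longrightarrow> h \<in> H \<Longrightarrow> (\<lambda>x. g x - h x) \<in> H"
    and comp_mem: "g \<in> H \<Longrightarrow> h \<in> H \<Longrightarrow> g \<circ> h \<in> H"
    and zmul_mem: "zmul n \<in> H \<Longrightarrow> n = 0"
begin

lemma uminus_mem: "h \<in> H \<Longrightarrow> (\<lambda>x. - h x) \<in> H"
  using diff_mem[OF zero_mem] by simp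

lemma add_mem: "g \<in> H \<Longrightarrow> h \<in> H \<Longrightarrow> (\<lambda>x. g x + h x) \<in> H"
  using diff_mem[OF _ uminus_mem] by fastforce

abbreviation End_sub :: "('a \<Rightarrow> 'a) ring"
  where "End_sub \<equiv> End_ring\<lparr>carrier := H\<rparr>"

lemma group_End_sub: "group (add_monoid End_sub)"
proof (rule groupI)
  show "\<exists>g\<in>carrier (add_monoid End_sub). g \<otimes>\<^bsub>add_monoid End_sub\<^esub> h = \<one>\<^bsub>add_monoid End_sub\<^esub>"
    if "h \<in> carrier (add_monoid End_sub)" for h
    using uminus_mem[of h] that by (intro bexI[of _ "\<lambda>x. - h x"]) (simp_all add: End_ring_def)
qed (simp_all add: End_ring_def add_mem zero_mem algebra_simps)

text \<open>Evaluation at a point is a homomorphism from the additive group of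
  \<open>End_sub\<close>, hence integer multiples are taken pointwise.\<close>

lemma add_pow_End_sub:
  assumes "h \<in> H"
  shows "[n] \<cdot>\<^bsub>End_sub\<^esub> h = (\<lambda>x. zmul (n :: int) (h x))" and "(\<lambda>x. zmul n (h x)) \<in> H"
proof -
  have "(\<lambda>h. h x) \<in> hom (add_monoid End_sub) additive_group" for x
    by (simp add: hom_def End_ring_def)
  from hom_int_pow[OF this _ group_End_sub comm_group.axioms(2)[OF comm_group_additive_group]]
  show *: "[n] \<cdot>\<^bsub>End_sub\<^esub> h = (\<lambda>x. zmul n (h x))"
    using assms unfolding add_pow_def zmul_def by (intro ext) simp
  have "[n] \<cdot>\<^bsub>End_sub\<^esub> h \<in> H"
    using group.int_pow_closed[OF group_End_sub, of h n] assms by (simp add: add_pow_def)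
  then show "(\<lambda>x. zmul n (h x)) \<in> H" by (simp add: *)
qed

definition op :: "int \<Rightarrow> ('a \<Rightarrow> 'a) \<Rightarrow> 'a \<Rightarrow> 'a"
  where "op n h = (\<lambda>x. zmul n x + h x)"

definition op_ring :: "('a \<Rightarrow> 'a) ring"
  where "op_ring = End_ring\<lparr>carrier := case_prod op ` (UNIV \<times> H)\<rparr>"

lemma op_ring_simps [simp]:
  "carrier op_ring = case_prod op ` (UNIV \<times> H)" "f \<otimes>\<^bsub>op_ring\<^esub> g = f \<circ> g" "\<one>\<^bsub>op_ring\<^esub> = id"
  "\<zero>\<^bsub>op_ring\<^esub> = (\<lambda>_. 0)" "f \<oplus>\<^bsub>op_ring\<^esub> g = (\<lambda>x. f x + g x)"
  by (simp_all add: op_ring_def End_ring_def)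

text \<open>From equality of the operators, (n - m) id = h - g lies in \<open>H\<close>, and
  \<open>zmul_mem\<close> gives n = m.\<close>

lemma op_inject:
  assumes "g \<in> H" "h \<in> H"
  shows "op n g = op m h \<longleftrightarrow> n = m \<and> g = h"
proof
  assume eq: "op n g = op m h"
  have "zmul (n - m) = (\<lambda>x. h x - g x)"
  proof
    fix x
    have "zmul n x = zmul m x + h x - g x"
      using fun_cong[OF eq, of x] by (simp add: op_def eq_diff_eq)
    then show "zmul (n - m) x = h x - g x"
      using zmul_add_left[of n "- m" x] by (simp add: zmul_uminus_left)
  qed
  then have "n - m = 0" using diff_mem[OF assms(2,1)] by (intro zmul_mem) simp
  then show "n = m \<and> g = h" using eq by (simp add: op_def fun_eq_iff)
qed simp

text \<open>Additivity of \<open>g\<close> lets it pass through the sum and through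
  \<open>zmul m\<close>. The result is the multiplication rule of the unitization.\<close>

lemma op_comp:
  assumes "g \<in> H" "h \<in> H"
  shows "op n g \<circ> op m h = op (n * m) (\<lambda>x. zmul n (h x) + zmul m (g x) + (g \<circ> h) x)"
    and "(\<lambda>x. zmul n (h x) + zmul m (g x) + (g \<circ> h) x) \<in> H"
proof -
  show "op n g \<circ> op m h = op (n * m) (\<lambda>x. zmul n (h x) + zmul m (g x) + (g \<circ> h) x)"
    using additive.add[OF additive[OF assms(1)]] additive_zmul[OF additive[OF assms(1)]]
    by (auto simp: op_def fun_eq_iff zmul_add_right zmul_mult algebra_simps)
  show "(\<lambda>x. zmul n (h x) + zmul m (g x) + (g \<circ> h) x) \<in> H"
    by (intro add_mem add_pow_End_sub comp_mem assms)
qed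

lemma op_add: "(\<lambda>x. op n g x + op m h x) = op (n + m) (\<lambda>x. g x + h x)"
  by (simp add: op_def zmul_add_left algebra_simps)

lemma id_eq_op: "id = op 1 (\<lambda>_. 0)" and op_0: "op 0 h = h"
  by (auto simp: op_def)

lemma additive_op: "h \<in> H \<Longrightarrow> additive (op n h)"
  using additive[of h] by (simp add: op_def additive_def zmul_add_right algebra_simps)

lemma op_in_carrier: "h \<in> H \<Longrightarrow> op n h \<in> carrier op_ring"
  by auto

lemma carrier_op_ringE:
  assumes "f \<in> carrier op_ring"
  obtains n h where "f = op n h" "h \<in> H"
  using assms by auto

lemma ring_op_ring: "ring op_ring"
proof (rule ringI)
  show "abelian_group op_ring"
  proof (rule abelian_groupI)
    fix f g assume "f \<in> carrier op_ring" "g \<in> carrier op_ring"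
    then obtain n h m k where "f = op n h" "g = op m k" "h \<in> H" "k \<in> H"
      by (elim carrier_op_ringE)
    then show "f \<oplus>\<^bsub>op_ring\<^esub> g \<in> carrier op_ring"
      using op_in_carrier[OF add_mem] by (simp only: op_ring_simps(5) op_add)
  next
    fix f assume "f \<in> carrier op_ring"
    then obtain n h where f: "f = op n h" "h \<in> H" by (rule carrier_op_ringE)
    then have "op (- n) (\<lambda>x. - h x) \<oplus>\<^bsub>op_ring\<^esub> f = \<zero>\<^bsub>op_ring\<^esub>"
      by (simp add: op_add) (simp add: op_def)
    then show "\<exists>g\<in>carrier op_ring. g \<oplus>\<^bsub>op_ring\<^esub> f = \<zero>\<^bsub>op_ring\<^esub>"
      using uminus_mem[OF f(2)] op_in_carrier by blast
  next
    show "\<zero>\<^bsub>op_ring\<^esub> \<in> carrier op_ring"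
      using op_in_carrier[OF zero_mem, of 0] by (simp add: op_0)
  qed (auto simp: algebra_simps)
  show "monoid op_ring"
  proof (rule monoidI)
    fix f g assume "f \<in> carrier op_ring" "g \<in> carrier op_ring"
    then obtain n h m k where "f = op n h" "g = op m k" "h \<in> H" "k \<in> H"
      by (elim carrier_op_ringE)
    then show "f \<otimes>\<^bsub>op_ring\<^esub> g \<in> carrier op_ring"
      using op_in_carrier[OF op_comp(2)] by (simp only: op_ring_simps(2) op_comp(1))
  next
    show "\<one>\<^bsub>op_ring\<^esub> \<in> carrier op_ring"
      using op_in_carrier[OF zero_mem, of 1] by (simp add: id_eq_op)
  qed (auto simp: comp_assoc)
  \<comment> \<open>This is the distributive law that needs additivity of the operators; the other
    one holds pointwise by definition.\<close>
  show "f \<otimes>\<^bsub>op_ring\<^esub> (g \<oplus>\<^bsub>op_ring\<^esub> h) = f \<otimes>\<^bsub>op_ring\<^esub> g \<oplus>\<^bsub>op_ring\<^esub> f \<otimes>\<^bsub>op_ring\<^esub> h"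
    if "f \<in> carrier op_ring" for f g h
    using that by (elim carrier_op_ringE) (simp add: fun_eq_iff additive.add[OF additive_op])
qed (auto simp: fun_eq_iff)

text \<open>\<open>H\<close> consists of the operators with integer part 0, and integer parts
  multiply under composition by \<open>op_comp\<close>.\<close>

lemma ideal_op_ring: "ideal H op_ring"
proof (rule idealI[OF ring_op_ring])
  have add: "group (add_monoid op_ring)"
    using abelian_group.a_group[OF ring.is_abelian_group[OF ring_op_ring]] .
  show "subgroup H (add_monoid op_ring)"
  proof (rule group.subgroupI[OF add])
    show "H \<subseteq> carrier (add_monoid op_ring)"
      using op_in_carrier[of _ 0] by (auto simp: op_0)
    show "inv\<^bsub>add_monoid op_ring\<^esub> h \<in> H" if h: "h \<in> H" for h
    proof -
      have "inv\<^bsub>add_monoid op_ring\<^esub> h = (\<lambda>x. - h x)"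
        using op_in_carrier[of h 0] op_in_carrier[OF uminus_mem[OF h], of 0] h
        by (intro group.inv_equality[OF add]) (simp_all add: op_0)
      then show ?thesis using uminus_mem[OF h] by simp
    qed
  qed (use zero_mem add_mem in auto)
  fix h f assume h: "h \<in> H" and "f \<in> carrier op_ring"
  then obtain n g where f: "f = op n g" "g \<in> H" by (auto elim: carrier_op_ringE)
  show "f \<otimes>\<^bsub>op_ring\<^esub> h \<in> H" "h \<otimes>\<^bsub>op_ring\<^esub> f \<in> H"
    using op_comp[OF f(2) h, of n 0] op_comp[OF h f(2), of 0 n] by (simp_all add: op_0 f(1))
qed

lemma op_ring_iso_unitization:
  "\<exists>\<psi>. \<psi> \<in> ring_iso op_ring (unitization End_sub) \<and> (\<forall>h\<in>H. \<psi> h = (0, h))"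
proof -
  \<comment> \<open>The map splitting an operator into its integer part and its part in
    \<open>H\<close>, well defined by \<open>op_inject\<close>.\<close>
  define \<psi> where "\<psi> = the_inv_into (UNIV \<times> H) (case_prod op)"
  have inj: "inj_on (case_prod op) (UNIV \<times> H)"
    using op_inject by (auto simp: inj_on_def)
  have \<psi>_op: "\<psi> (op n h) = (n, h)" if "h \<in> H" for n h
    using the_inv_into_f_f[OF inj, of "(n, h)"] that by (simp add: \<psi>_def)
  have "bij_betw \<psi> (carrier op_ring) (carrier (unitization End_sub))"
    using bij_betw_the_inv_into[OF inj_on_imp_bij_betw[OF inj]]
    by (simp add: \<psi>_def unitization_def)
  moreover have "\<psi> \<in> ring_hom op_ring (unitization End_sub)"
  proof (rule ring_hom_memI)
    fix f g assume "f \<in> carrier op_ring" "g \<in> carrier op_ring"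
    then obtain n h m k where *: "f = op n h" "g = op m k" "h \<in> H" "k \<in> H"
      by (elim carrier_op_ringE)
    show "\<psi> f \<in> carrier (unitization End_sub)"
      using * by (simp add: \<psi>_op unitization_def)
    show "\<psi> (f \<otimes>\<^bsub>op_ring\<^esub> g) = \<psi> f \<otimes>\<^bsub>unitization End_sub\<^esub> \<psi> g"
      using * op_comp[OF *(3,4), of n m] by (simp add: \<psi>_op unitization_def add_pow_End_sub)
        (simp add: End_ring_def)
    show "\<psi> (f \<oplus>\<^bsub>op_ring\<^esub> g) = \<psi> f \<oplus>\<^bsub>unitization End_sub\<^esub> \<psi> g"
      using * add_mem[OF *(3,4)] by (simp add: op_add \<psi>_op unitization_def)
        (simp add: End_ring_def)
  next
    show "\<psi> \<one>\<^bsub>op_ring\<^esub> = \<one>\<^bsub>unitization End_sub\<^esub>"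
      using zero_mem by (simp add: id_eq_op \<psi>_op unitization_def) (simp add: End_ring_def)
  qed
  moreover have "\<psi> h = (0, h)" if "h \<in> H" for h
    using \<psi>_op[OF that, of 0] by (simp add: op_0)
  ultimately show ?thesis by (auto simp: ring_iso_def)
qed

end

section \<open>The ring \<open>\<O>(T\<^sub>\<mu>,\<int>)\<close>\<close>

text \<open>Complements \<open>tensor4_hom_eqI\<close>: it proves properties closed under
  differences, such as membership in a subgroup.\<close>

lemma tensor4_induct [case_names pure diff]:
  fixes t :: "((('a::ab_group_add, 'b::ab_group_add) tensor, 'c::ab_group_add) tensor,
    'd::ab_group_add) tensor"
  assumes pure: "\<And>a b c d. P (a \<otimes>\<^sub>\<int> b \<otimes>\<^sub>\<int> c \<otimes>\<^sub>\<int> d)"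
    and diff: "\<And>x y. P x \<Longrightarrow> P y \<Longrightarrow> P (x - y)"
  shows "P t"
proof (induction t rule: tensor_induct)
  case (pure t3 d)
  show ?case
  proof (induction t3 rule: tensor_induct)
    case (pure t2 c)
    show ?case
      by (induction t2 rule: tensor_induct)
        (simp_all add: assms additive.diff[OF additive_pure_left])
  qed (simp add: diff additive.diff[OF additive_pure_left])
qed (rule diff)

text \<open>
  The isomorphism \<open>F(T\<^sub>\<mu>,\<int>) \<cong> P \<oplus> (L \<oplus> R) \<oplus> (W \<otimes> W)\<close> and its inverse. The defining ideal of
  \<open>\<O>(T\<^sub>\<mu>,\<int>)\<close> corresponds to \<open>0 \<oplus> im B\<^sub>\<mu> \<oplus> (W \<otimes> W)\<close>.
\<close>

definition F_proj ::
    "((('e::ab_group_add \<times> 'w::ab_group_add, int) tensor, 'e \<times> 'w) tensor, int) tensor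
      \<Rightarrow> ('e, 'e) tensor \<times> (('w, 'e) tensor \<times> ('e, 'w) tensor) \<times> ('w, 'w) tensor"
  where "F_proj = tensor_lift4 (\<lambda>x n y m. zmul (n * m)
    (fst x \<otimes>\<^sub>\<int> fst y, (snd x \<otimes>\<^sub>\<int> fst y, fst x \<otimes>\<^sub>\<int> snd y), snd x \<otimes>\<^sub>\<int> snd y))"

definition F_incl ::
    "('e::ab_group_add, 'e) tensor \<times> (('w::ab_group_add, 'e) tensor \<times> ('e, 'w) tensor) \<times> ('w, 'w) tensor
      \<Rightarrow> ((('e \<times> 'w, int) tensor, 'e \<times> 'w) tensor, int) tensor"
  where "F_incl = (\<lambda>(p, (l, r), s).
    tensor_lift (\<lambda>a b. (a, 0) \<otimes>\<^sub>\<int> 1 \<otimes>\<^sub>\<int> (b, 0) \<otimes>\<^sub>\<int> 1) p +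
    tensor_lift (\<lambda>w b. (0, w) \<otimes>\<^sub>\<int> 1 \<otimes>\<^sub>\<int> (b, 0) \<otimes>\<^sub>\<int> 1) l +
    tensor_lift (\<lambda>a w. (a, 0) \<otimes>\<^sub>\<int> 1 \<otimes>\<^sub>\<int> (0, w) \<otimes>\<^sub>\<int> 1) r +
    tensor_lift (\<lambda>w w'. (0, w) \<otimes>\<^sub>\<int> 1 \<otimes>\<^sub>\<int> (0, w') \<otimes>\<^sub>\<int> 1) s)"

lemma quadadditive_F_proj: "quadadditive (\<lambda>x n y m. zmul (n * m)
    (fst x \<otimes>\<^sub>\<int> fst y, (snd x \<otimes>\<^sub>\<int> fst y, fst x \<otimes>\<^sub>\<int> snd y), snd x \<otimes>\<^sub>\<int> snd y))"
  by (simp add: quadadditive_def additive_def tensor_pure_add_left tensor_pure_add_right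
      zmul_add_left zmul_add_right distrib_left distrib_right)

lemma additive_F_proj: "additive F_proj"
  unfolding F_proj_def by (rule additive_tensor_lift4[OF quadadditive_F_proj])

lemma F_proj_pure: "F_proj (x \<otimes>\<^sub>\<int> n \<otimes>\<^sub>\<int> y \<otimes>\<^sub>\<int> m) = zmul (n * m)
    (fst x \<otimes>\<^sub>\<int> fst y, (snd x \<otimes>\<^sub>\<int> fst y, fst x \<otimes>\<^sub>\<int> snd y), snd x \<otimes>\<^sub>\<int> snd y)"
  unfolding F_proj_def by (rule tensor_lift4_pure[OF quadadditive_F_proj])

lemma biadditive_F_pure:
  assumes "additive i" "additive j"
  shows "biadditive (\<lambda>a b. i a \<otimes>\<^sub>\<int> (1 :: int) \<otimes>\<^sub>\<int> j b \<otimes>\<^sub>\<int> (1 :: int))"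
  by (simp add: biadditive_def additive_def additive.add[OF assms(1)] additive.add[OF assms(2)]
      tensor_pure_add_left tensor_pure_add_right)

lemma additive_Pair_zero: "additive (\<lambda>a. (a, 0))" "additive (\<lambda>b. (0, b))"
  by (simp_all add: additive_def)

text \<open>The four instances belong to the summands P, L, R and W \<otimes> W, in this
  order.\<close>

lemmas F_incl_pure =
  tensor_lift_pure[OF biadditive_F_pure[OF additive_Pair_zero(1) additive_Pair_zero(1)]]
  tensor_lift_pure[OF biadditive_F_pure[OF additive_Pair_zero(2) additive_Pair_zero(1)]]
  tensor_lift_pure[OF biadditive_F_pure[OF additive_Pair_zero(1) additive_Pair_zero(2)]]
  tensor_lift_pure[OF biadditive_F_pure[OF additive_Pair_zero(2) additive_Pair_zero(2)]]

lemmas F_incl_additive =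
  additive_tensor_lift[OF biadditive_F_pure[OF additive_Pair_zero(1) additive_Pair_zero(1)]]
  additive_tensor_lift[OF biadditive_F_pure[OF additive_Pair_zero(2) additive_Pair_zero(1)]]
  additive_tensor_lift[OF biadditive_F_pure[OF additive_Pair_zero(1) additive_Pair_zero(2)]]
  additive_tensor_lift[OF biadditive_F_pure[OF additive_Pair_zero(2) additive_Pair_zero(2)]]

lemma additive_F_incl: "additive F_incl"
  by (auto simp: additive_def F_incl_def F_incl_additive[THEN additive.add] algebra_simps)

lemma F_proj_incl:
  fixes x :: "('e::ab_group_add, 'e) tensor \<times> (('w::ab_group_add, 'e) tensor \<times> ('e, 'w) tensor) \<times>
    ('w, 'w) tensor"
  shows "F_proj (F_incl x) = x"
proof -
  obtain p l r s where x: "x = (p, (l, r), s)" by (metis surj_pair)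
  note simps = F_incl_pure F_proj_pure
  have "F_proj (tensor_lift (\<lambda>a b. (a, 0 :: 'w) \<otimes>\<^sub>\<int> 1 \<otimes>\<^sub>\<int> (b, 0 :: 'w) \<otimes>\<^sub>\<int> 1) p) = (p, 0, 0)"
    by (rule tensor_hom_eqI[OF additive_comp[OF additive_F_proj F_incl_additive(1)]])
      (simp_all add: additive_def simps zero_prod_def)
  moreover have "F_proj (tensor_lift (\<lambda>w b. (0, w) \<otimes>\<^sub>\<int> 1 \<otimes>\<^sub>\<int> (b, 0) \<otimes>\<^sub>\<int> 1) l) = (0, (l, 0), 0)"
    by (rule tensor_hom_eqI[OF additive_comp[OF additive_F_proj F_incl_additive(2)]])
      (simp_all add: additive_def simps)
  moreover have "F_proj (tensor_lift (\<lambda>a w. (a, 0) \<otimes>\<^sub>\<int> 1 \<otimes>\<^sub>\<int> (0, w) \<otimes>\<^sub>\<int> 1) r) = (0, (0, r), 0)"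
    by (rule tensor_hom_eqI[OF additive_comp[OF additive_F_proj F_incl_additive(3)]])
      (simp_all add: additive_def simps)
  moreover have "F_proj (tensor_lift (\<lambda>w w'. (0 :: 'e, w) \<otimes>\<^sub>\<int> 1 \<otimes>\<^sub>\<int> (0 :: 'e, w') \<otimes>\<^sub>\<int> 1) s) = (0, 0, s)"
    by (rule tensor_hom_eqI[OF additive_comp[OF additive_F_proj F_incl_additive(4)]])
      (simp_all add: additive_def simps zero_prod_def)
  ultimately show ?thesis
    by (simp add: x F_incl_def additive.add[OF additive_F_proj])
qed

lemma F_incl_proj: "F_incl (F_proj f) = f"
proof (rule tensor4_hom_eqI[OF additive_comp[OF additive_F_incl additive_F_proj]])
  fix x y :: "'a \<times> 'b" and n m :: int
  \<comment> \<open>Writing n and m as multiples of 1 moves both integers out of the tensor.\<close>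
  have "x \<otimes>\<^sub>\<int> n \<otimes>\<^sub>\<int> y \<otimes>\<^sub>\<int> m = x \<otimes>\<^sub>\<int> zmul n 1 \<otimes>\<^sub>\<int> y \<otimes>\<^sub>\<int> zmul m 1" by simp
  also have "\<dots> = zmul (n * m) (x \<otimes>\<^sub>\<int> 1 \<otimes>\<^sub>\<int> y \<otimes>\<^sub>\<int> 1)"
    by (simp only: zmul_tensor_left zmul_tensor_right zmul_mult) (simp add: mult.commute)
  \<comment> \<open>Splitting \<open>x\<close> and \<open>y\<close> into their E and W parts gives
    four terms, one for each summand of \<open>F_incl\<close>.\<close>
  also have "x \<otimes>\<^sub>\<int> 1 \<otimes>\<^sub>\<int> y \<otimes>\<^sub>\<int> 1 =
      ((fst x, 0) + (0, snd x)) \<otimes>\<^sub>\<int> (1 :: int) \<otimes>\<^sub>\<int> ((fst y, 0) + (0, snd y)) \<otimes>\<^sub>\<int> (1 :: int)" by simp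
  also have "\<dots> =
      F_incl (fst x \<otimes>\<^sub>\<int> fst y, (snd x \<otimes>\<^sub>\<int> fst y, fst x \<otimes>\<^sub>\<int> snd y), snd x \<otimes>\<^sub>\<int> snd y)"
    by (simp only: F_incl_def prod.case F_incl_pure tensor_pure_add_left tensor_pure_add_right)
      (simp add: algebra_simps)
  finally show "F_incl (F_proj (x \<otimes>\<^sub>\<int> n \<otimes>\<^sub>\<int> y \<otimes>\<^sub>\<int> m)) = x \<otimes>\<^sub>\<int> n \<otimes>\<^sub>\<int> y \<otimes>\<^sub>\<int> m"
    unfolding F_proj_pure additive_zmul[OF additive_F_incl] by (rule sym)
qed (simp add: additive_def)

section \<open>The action and product in components, and the defining ideal\<close>

locale two_step_system =
  fixes \<mu> :: "(('e::ab_group_add, 'e) tensor, 'e) tensor \<Rightarrow> 'w::ab_group_add"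
  assumes additive_mu: "additive \<mu>"
begin

sublocale ternary_gamma_ring "two_step \<mu>"
  by (rule ternary_gamma_ring_two_step[OF additive_mu])

lemma additive_Theta: "additive (Theta \<mu> p)" "additive (\<lambda>p. Theta \<mu> p c)"
  by (simp_all add: Theta_def additive_def tensor_pure_add_left tensor_pure_add_right
      additive.add[OF additive_mu])

lemma Theta_zero: "Theta \<mu> 0 = (\<lambda>_. 0)" and Theta_diff: "Theta \<mu> (p - q) c = Theta \<mu> p c - Theta \<mu> q c"
  using additive_zero[OF additive_Theta(2)] additive.diff[OF additive_Theta(2)] by auto

text \<open>The ternary product sees only the E components of its entries, so of a pure tensor only
  the P component acts. Both sides are additive in \<open>f\<close>.\<close>

lemma gamma_act_two_step: "gamma_act (two_step \<mu>) f = hom_embed (Theta \<mu> (fst (F_proj f)))"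
proof
  fix x
  show "gamma_act (two_step \<mu>) f x = hom_embed (Theta \<mu> (fst (F_proj f))) x"
  proof (rule tensor4_hom_eqI[OF additive_gamma_act(2)])
    show "additive (\<lambda>f. hom_embed (Theta \<mu> (fst (F_proj f))) x)"
      by (simp add: additive_def hom_embed_def split_beta additive.add[OF additive_F_proj]
          additive.add[OF additive_Theta(2)])
    show "gamma_act (two_step \<mu>) (a \<otimes>\<^sub>\<int> \<alpha> \<otimes>\<^sub>\<int> b \<otimes>\<^sub>\<int> \<beta>) x =
        hom_embed (Theta \<mu> (fst (F_proj (a \<otimes>\<^sub>\<int> \<alpha> \<otimes>\<^sub>\<int> b \<otimes>\<^sub>\<int> \<beta>)))) x" for a b \<alpha> \<beta>
      by (simp add: gamma_act_pure two_step_def F_proj_pure hom_embed_def split_beta Theta_def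
          zmul_tensor_left additive_zmul[OF additive_mu])
  qed
qed

lemma biadditive_Theta_pure: "biadditive (\<lambda>c d. Theta \<mu> p c \<otimes>\<^sub>\<int> d)"
  by (simp add: biadditive_def additive_def tensor_pure_add_left tensor_pure_add_right
      additive.add[OF additive_Theta(1)])

text \<open>The first entry of a product lies in W, so the components in P = E \<otimes> E and R = E
  \<otimes> W vanish. The W \<otimes> W component is left uncomputed because it is absorbed by the
  ideal.\<close>

lemma F_proj_mult:
  shows "fst (F_proj (f \<otimes>\<^bsub>F_ring (two_step \<mu>)\<^esub> g)) = 0"
    and "fst (snd (F_proj (f \<otimes>\<^bsub>F_ring (two_step \<mu>)\<^esub> g))) =
      (tensor_lift (\<lambda>c d. Theta \<mu> (fst (F_proj f)) c \<otimes>\<^sub>\<int> d) (fst (F_proj g)), 0)"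
proof -
  have add: "additive (\<lambda>g. F_proj (f \<otimes>\<^bsub>F_ring (two_step \<mu>)\<^esub> g))"
    by (rule additive_comp[OF additive_F_proj additive_F_ring_mult(1)])
  show "fst (F_proj (f \<otimes>\<^bsub>F_ring (two_step \<mu>)\<^esub> g)) = 0"
    by (rule tensor4_hom_eqI[of _ "\<lambda>_. 0"])
      (simp_all add: additive_def additive.add[OF add] F_ring_mult_pure_right F_proj_pure
        gamma_act_two_step hom_embed_def split_beta)
  show "fst (snd (F_proj (f \<otimes>\<^bsub>F_ring (two_step \<mu>)\<^esub> g))) =
      (tensor_lift (\<lambda>c d. Theta \<mu> (fst (F_proj f)) c \<otimes>\<^sub>\<int> d) (fst (F_proj g)), 0)"
    by (rule tensor4_hom_eqI[of _
          "\<lambda>g. (tensor_lift (\<lambda>c d. Theta \<mu> (fst (F_proj f)) c \<otimes>\<^sub>\<int> d) (fst (F_proj g)), 0)"])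
      (simp_all add: additive_def additive.add[OF add] F_ring_mult_pure_right F_proj_pure
        gamma_act_two_step hom_embed_def split_beta additive.add[OF additive_F_proj]
        additive.add[OF additive_tensor_lift[OF biadditive_Theta_pure]]
        additive_zmul[OF additive_tensor_lift[OF biadditive_Theta_pure]]
        tensor_lift_pure[OF biadditive_Theta_pure])
qed

text \<open>An explicit candidate for the ideal generated by the relators. The third component is
  unrestricted, so all of W \<otimes> W is included.\<close>

definition J :: "((('e \<times> 'w, int) tensor, 'e \<times> 'w) tensor, int) tensor set"
  where "J = {f. fst (F_proj f) = 0 \<and> fst (snd (F_proj f)) \<in> range (B_map \<mu>)}"

sublocale B: additive_coset "range (B_map \<mu>)"
proof (rule additive_coset.intro)
  have "B_map \<mu> 0 = 0" by (rule additive_zero[OF additive_B_map[OF additive_mu]])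
  then show "subgroup (range (B_map \<mu>)) additive_group"
    by (auto simp: subgroup_additive_group_iff image_iff
        additive.diff[OF additive_B_map[OF additive_mu], symmetric] intro: exI[of _ 0])
qed

lemma subgroup_J: "subgroup J additive_group"
  by (auto simp: J_def subgroup_additive_group_iff additive_zero[OF additive_F_proj]
      additive.diff[OF additive_F_proj] B.zero_mem intro: B.diff_mem)

lemma mem_J_iff: "f \<in> J \<longleftrightarrow> fst (F_proj f) = 0 \<and> fst (snd (F_proj f)) \<in> range (B_map \<mu>)"
  by (simp add: J_def)

sublocale J: additive_coset J
  by (rule additive_coset.intro[OF subgroup_J])

lemma Theta_lift_zero: "tensor_lift (\<lambda>c d. Theta \<mu> 0 c \<otimes>\<^sub>\<int> d) t = 0"
  by (rule tensor_hom_eqI[OF additive_tensor_lift[OF biadditive_Theta_pure], of "\<lambda>_. 0"])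
    (simp_all add: additive_def tensor_lift_pure[OF biadditive_Theta_pure], simp add: Theta_zero)

text \<open>By \<open>F_proj_mult\<close> the first two components of a product depend only on the P
  components of the factors. If one of these is 0, the product lands in W \<otimes> W.\<close>

lemma rng_ideal_Oid: "rng_ideal J (F_ring (two_step \<mu>))"
proof -
  have "f \<otimes>\<^bsub>F_ring (two_step \<mu>)\<^esub> g \<in> J" if "f \<in> J \<or> g \<in> J" for f g
    using that B.zero_mem unfolding J_def zero_prod_def
    by (auto simp: F_proj_mult Theta_lift_zero
        additive_zero[OF additive_tensor_lift[OF biadditive_Theta_pure]])
  then show ?thesis
    by (simp add: rng_ideal_F_ring_iff subgroup_J)
qed

lemma O_relators_subset_J: "O_relators (two_step \<mu>) \<subseteq> J"
proof
  fix f assume "f \<in> O_relators (two_step \<mu>)"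
  then obtain a \<alpha> b \<beta> c \<gamma> d \<delta> where f: "f = two_step \<mu> a \<alpha> b \<beta> c \<otimes>\<^sub>\<int> \<gamma> \<otimes>\<^sub>\<int> d \<otimes>\<^sub>\<int> \<delta> -
      a \<otimes>\<^sub>\<int> \<alpha> \<otimes>\<^sub>\<int> two_step \<mu> b \<beta> c \<gamma> d \<otimes>\<^sub>\<int> \<delta>"
    unfolding O_relators_def by blast
  \<comment> \<open>The inner products have zero E component, so the first term of the relator
    contributes only to L and the second only to R. All four integers factor out of the resulting
    value of \<open>B_map\<close>.\<close>
  have "fst (snd (F_proj f)) =
      zmul (\<alpha> * \<beta> * \<gamma> * \<delta>) (B_map \<mu> (fst a \<otimes>\<^sub>\<int> fst b \<otimes>\<^sub>\<int> fst c \<otimes>\<^sub>\<int> fst d))"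
    by (simp add: f additive.diff[OF additive_F_proj] F_proj_pure two_step_def
        B_map_pure[OF additive_mu] zmul_tensor_left zmul_tensor_right zmul_mult mult_ac
        additive_zmul[of uminus] additive_def)
  also have "\<dots> \<in> range (B_map \<mu>)"
    by (simp flip: additive_zmul[OF additive_B_map[OF additive_mu]])
  finally show "f \<in> J"
    by (simp add: J_def f additive.diff[OF additive_F_proj] F_proj_pure two_step_def)
qed

lemma rng_genideal_O_relators:
  assumes "surj \<mu>"
  shows "rng_genideal (F_ring (two_step \<mu>)) (O_relators (two_step \<mu>)) = J"
proof
  show "rng_genideal (F_ring (two_step \<mu>)) (O_relators (two_step \<mu>)) \<subseteq> J"
    using rng_ideal_Oid O_relators_subset_J unfolding rng_genideal_def by blast
  show "J \<subseteq> rng_genideal (F_ring (two_step \<mu>)) (O_relators (two_step \<mu>))"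
    unfolding rng_genideal_def
  proof (intro Inter_greatest subsetI)
    fix I f
    assume I: "I \<in> {I. rng_ideal I (F_ring (two_step \<mu>)) \<and> O_relators (two_step \<mu>) \<subseteq> I}"
      and f: "f \<in> J"
    interpret I: additive_coset I
      using I by (intro additive_coset.intro) (simp add: rng_ideal_F_ring_iff)
    \<comment> \<open>Relators with integer entries 1 are enough, since \<open>F_incl\<close> uses
      only such tensors.\<close>
    have rel: "two_step \<mu> a 1 b 1 c \<otimes>\<^sub>\<int> 1 \<otimes>\<^sub>\<int> d \<otimes>\<^sub>\<int> 1 - a \<otimes>\<^sub>\<int> 1 \<otimes>\<^sub>\<int> two_step \<mu> b 1 c 1 d \<otimes>\<^sub>\<int> 1 \<in> I"
      for a b c d
      using I unfolding O_relators_def by blast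
    have add_B: "additive (\<lambda>t. F_incl (0, B_map \<mu> t, 0))"
      by (intro additive_comp[OF additive_F_incl])
        (simp add: additive_def additive.add[OF additive_B_map[OF additive_mu]])
    \<comment> \<open>On pure tensors these are the relators with all four entries in E.\<close>
    have B: "F_incl (0, B_map \<mu> t, 0) \<in> I" for t
    proof (induction t rule: tensor4_induct)
      case (pure a b c d)
      show ?case
        using rel[of "(a, 0)" "(b, 0)" "(c, 0)" "(d, 0)"]
        by (simp add: two_step_def B_map_pure[OF additive_mu] F_incl_def F_incl_pure
            F_incl_additive[THEN additive_zero] F_incl_additive[THEN additive.minus])
    qed (simp add: additive.diff[OF add_B] I.diff_mem)
    have add_s: "additive (\<lambda>s. F_incl (0, 0, s))"
      by (intro additive_comp[OF additive_F_incl]) (simp add: additive_def)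
    have s: "F_incl (0, 0, s) \<in> I" for s
    proof (induction s rule: tensor_induct)
      case (pure w w')
      \<comment> \<open>Surjectivity reduces the second factor to values of \<mu>, and by additivity
        to values on pure tensors.\<close>
      obtain t where w': "w' = \<mu> t" using assms by (rule surjE)
      have add_t: "additive (\<lambda>t. F_incl (0, 0, w \<otimes>\<^sub>\<int> \<mu> t))"
        by (intro additive_comp[OF add_s] additive_comp[OF additive_pure_right additive_mu])
      show ?case
        unfolding w'
      proof (induction t rule: tensor_induct)
        case (pure p c)
        show ?case
        proof (induction p rule: tensor_induct)
          case (pure a b)
          show ?case
            \<comment> \<open>With first entry in W the inner product of the first term is 0, so the
              relator is minus the tensor of w and \<mu>(a,b,c).\<close>
            using I.uminus_mem[OF rel[of "(0, w)" "(a, 0)" "(b, 0)" "(c, 0)"]]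
            by (simp add: two_step_def F_incl_def F_incl_pure zero_prod_def[symmetric]
                additive_zero[OF additive_mu] F_incl_additive[THEN additive_zero])
              (simp add: zero_prod_def F_incl_additive[THEN additive_zero] F_incl_pure)
        qed (simp add: additive.diff[OF additive_comp[OF add_t additive_pure_left]] I.diff_mem)
      qed (simp add: additive.diff[OF add_t] I.diff_mem)
    qed (simp add: additive.diff[OF add_s] I.diff_mem)
    obtain t s where "F_proj f = (0, B_map \<mu> t, 0) + (0, 0, s)"
      using f by (cases "F_proj f") (auto simp: J_def)
    then have "f = F_incl (0, B_map \<mu> t, 0) + F_incl (0, 0, s)"
      by (metis F_incl_proj additive.add[OF additive_F_incl])
    then show "f \<in> I" using I.add_mem[OF B s] by simp
  qed
qed

end

text \<open>\<open>ideal_prod\<close> is generated by products under addition, so 0 + 0 = 0 closes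
  the induction, and nonempty factors ensure that 0 occurs as a product. No ring axioms are
  presupposed, so this applies to O and A as records.\<close>

lemma ideal_prod_eq_zero:
  fixes R (structure)
  assumes "\<And>a b. a \<in> A \<Longrightarrow> b \<in> B \<Longrightarrow> a \<otimes> b = \<zero>" and "A \<noteq> {}" and "B \<noteq> {}" and "\<zero> \<oplus> \<zero> = \<zero>"
  shows "ideal_prod R A B = {\<zero>}"
proof -
  have "x = \<zero>" if "x \<in> ideal_prod R A B" for x
    using that by induction (simp_all add: assms)
  moreover have "\<zero> \<in> ideal_prod R A B"
    using assms(1-3) ideal_prod.prod[of _ A _ B R] by (metis ex_in_conv)
  ultimately show ?thesis by blast
qed

lemma hom_embed_eq_zero_iff: "hom_embed \<phi> = (\<lambda>_. 0) \<longleftrightarrow> \<phi> = (\<lambda>_. 0)"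
  by (auto simp: hom_embed_def fun_eq_iff zero_prod_def)

section \<open>The quotient ring for surjective \<mu>: splitting, powers and intrinsic
  defect\<close>

locale surj_two_step_system = two_step_system +
  assumes surj_mu: "surj \<mu>"
begin

abbreviation coset (infixl "\<hash>" 60)
  where "H \<hash> x \<equiv> H #>\<^bsub>additive_group\<^esub> x"

lemma O_ring_eq: "O_ring (two_step \<mu>) = F_ring (two_step \<mu>) Quot J"
  by (simp add: O_ring_def rng_genideal_O_relators[OF surj_mu])

lemmas O_ring_simps = carrier_Quot[OF rng_ideal_Oid, folded O_ring_eq]
  zero_Quot[OF rng_ideal_Oid, folded O_ring_eq]
  add_Quot[OF rng_ideal_Oid, folded O_ring_eq]
  mult_Quot[OF rng_ideal_Oid, folded O_ring_eq]

lemma O_ringE: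
  assumes "u \<in> carrier (O_ring (two_step \<mu>))"
  obtains f where "u = J \<hash> f"
  using assms by (auto simp: O_ring_simps)

text \<open>The isomorphism onto P \<oplus> Q. Elements of O are cosets of \<open>J\<close>, and on
  each of them the P component and the class of the L \<oplus> R component are constant.\<close>

definition O_split where
  "O_split u = the_elem ((\<lambda>f. (fst (F_proj f), range (B_map \<mu>) \<hash> fst (snd (F_proj f)))) ` u)"

lemma O_split_coset: "O_split (J \<hash> f) = (fst (F_proj f), range (B_map \<mu>) \<hash> fst (snd (F_proj f)))"
  unfolding O_split_def
  by (rule J.the_elem_image_coset)
    (simp add: B.coset_eq_iff mem_J_iff additive.diff[OF additive_F_proj])

lemma Q_group_simps: "carrier (Q_group \<mu>) = range (\<lambda>x. range (B_map \<mu>) \<hash> x)"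
  "(range (B_map \<mu>) \<hash> x) \<otimes>\<^bsub>Q_group \<mu>\<^esub> (range (B_map \<mu>) \<hash> y) = range (B_map \<mu>) \<hash> (x + y)"
  by (simp_all add: Q_group_def FactGroup_def B.rcosets_eq B.coset_add)

lemma O_split_iso: "O_split \<in> iso (add_monoid (O_ring (two_step \<mu>))) (additive_group \<times>\<times> Q_group \<mu>)"
proof -
  have "O_split u \<in> UNIV \<times> carrier (Q_group \<mu>)" if "u \<in> carrier (O_ring (two_step \<mu>))" for u
    using that by (auto elim!: O_ringE simp: O_split_coset Q_group_simps)
  moreover have "O_split (u \<oplus>\<^bsub>O_ring (two_step \<mu>)\<^esub> v) =
      O_split u \<otimes>\<^bsub>additive_group \<times>\<times> Q_group \<mu>\<^esub> O_split v"
    if "u \<in> carrier (O_ring (two_step \<mu>))" "v \<in> carrier (O_ring (two_step \<mu>))" for u v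
    using that
    by (auto elim!: O_ringE simp: O_ring_simps O_split_coset Q_group_simps
        additive.add[OF additive_F_proj])
  moreover have "inj_on O_split (carrier (O_ring (two_step \<mu>)))"
  proof (rule inj_onI)
    fix u v
    assume *: "u \<in> carrier (O_ring (two_step \<mu>))" "v \<in> carrier (O_ring (two_step \<mu>))"
      "O_split u = O_split v"
    then obtain f g where "u = J \<hash> f" "v = J \<hash> g" by (elim O_ringE)
    then show "u = v"
      using *(3) by (simp add: O_split_coset J.coset_eq_iff B.coset_eq_iff mem_J_iff
        additive.diff[OF additive_F_proj])
  qed
  moreover have "(p, q) \<in> O_split ` carrier (O_ring (two_step \<mu>))" if q: "q \<in> carrier (Q_group \<mu>)" for p q
  proof -
    obtain x where x: "q = range (B_map \<mu>) \<hash> x" using q unfolding Q_group_simps by blast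
    \<comment> \<open>A preimage is built by \<open>F_incl\<close> with W \<otimes> W component
      0.\<close>
    have "O_split (J \<hash> F_incl (p, x, 0)) = (p, q)"
      by (simp add: O_split_coset F_proj_incl x)
    then show ?thesis unfolding O_ring_simps(1) by (metis image_eqI rangeI)
  qed
  ultimately have "O_split ` carrier (O_ring (two_step \<mu>)) = UNIV \<times> carrier (Q_group \<mu>)"
    and "O_split \<in> hom (add_monoid (O_ring (two_step \<mu>))) (additive_group \<times>\<times> Q_group \<mu>)"
    and "inj_on O_split (carrier (O_ring (two_step \<mu>)))"
    by (blast, simp add: hom_def, blast)
  then show ?thesis by (simp add: iso_iff)
qed

lemma O_split_mult:
  assumes "u \<in> carrier (O_ring (two_step \<mu>))" and "v \<in> carrier (O_ring (two_step \<mu>))"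
  shows "O_split (u \<otimes>\<^bsub>O_ring (two_step \<mu>)\<^esub> v) = (0, m_bar \<mu> (fst (O_split u)) (fst (O_split v)))"
  using assms by (auto elim!: O_ringE simp: O_ring_simps O_split_coset F_proj_mult m_bar_def)

lemma regular_rep_two_step:
  assumes "u \<in> carrier (O_ring (two_step \<mu>))"
  shows "regular_rep (two_step \<mu>) u = hom_embed (Theta \<mu> (fst (O_split u)))"
proof -
  obtain f where u: "u = J \<hash> f" using assms by (rule O_ringE)
  have "regular_rep (two_step \<mu>) (J \<hash> f) = gamma_act (two_step \<mu>) f"
    unfolding regular_rep_def
    by (rule J.the_elem_image_coset)
      (simp add: gamma_act_two_step mem_J_iff additive.diff[OF additive_F_proj])
  then show ?thesis by (simp add: u gamma_act_two_step O_split_coset)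
qed

text \<open>The inner map has values in W, and the outer one reads only the E component.\<close>

lemma hom_embed_comp: "hom_embed (Theta \<mu> p) \<circ> hom_embed \<phi> = (\<lambda>_. 0)"
  by (auto simp: hom_embed_def fun_eq_iff additive_zero[OF additive_Theta(1)] zero_prod_def)

lemma intrinsic_defect_eq: "intrinsic_defect (two_step \<mu>) =
    {u \<in> carrier (O_ring (two_step \<mu>)). Theta \<mu> (fst (O_split u)) = (\<lambda>_. 0)}"
  by (auto simp: intrinsic_defect_def a_kernel_def kernel_def End_ring_def regular_rep_two_step
      hom_embed_eq_zero_iff)

lemma O_split_iso_defect:
  "O_split \<in> iso ((add_monoid (O_ring (two_step \<mu>)))\<lparr>carrier := intrinsic_defect (two_step \<mu>)\<rparr>)
    (additive_group\<lparr>carrier := {p. Theta \<mu> p = (\<lambda>_. 0)}\<rparr> \<times>\<times> Q_group \<mu>)"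
proof -
  have hom: "O_split \<in> hom (add_monoid (O_ring (two_step \<mu>))) (additive_group \<times>\<times> Q_group \<mu>)"
    and img: "O_split ` carrier (O_ring (two_step \<mu>)) = UNIV \<times> carrier (Q_group \<mu>)"
    and inj: "inj_on O_split (carrier (O_ring (two_step \<mu>)))"
    using O_split_iso by (auto simp: iso_iff)
  have "O_split ` intrinsic_defect (two_step \<mu>) = {p. Theta \<mu> p = (\<lambda>_. 0)} \<times> carrier (Q_group \<mu>)"
  proof -
    \<comment> \<open>The defect is cut out of O by a condition on the P component alone, so its
      image is the corresponding slice of the full product.\<close>
    have "O_split ` intrinsic_defect (two_step \<mu>) =
        O_split ` carrier (O_ring (two_step \<mu>)) \<inter> {x. Theta \<mu> (fst x) = (\<lambda>_. 0)}"
      by (auto simp: intrinsic_defect_eq)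
    then show ?thesis by (auto simp: img)
  qed
  moreover have "inj_on O_split (intrinsic_defect (two_step \<mu>))"
    using inj by (rule inj_on_subset) (auto simp: intrinsic_defect_eq)
  moreover have "intrinsic_defect (two_step \<mu>) \<subseteq> carrier (O_ring (two_step \<mu>))"
    by (auto simp: intrinsic_defect_eq)
  ultimately show ?thesis
    using hom by (auto simp: iso_iff hom_def DirProd_def split_beta Pi_def subset_iff)
qed

lemma zero_in_O_ring: "\<zero>\<^bsub>O_ring (two_step \<mu>)\<^esub> \<in> carrier (O_ring (two_step \<mu>))"
  using J.coset_zero by (auto simp: O_ring_simps simp del: J.coset_zero)

lemma zero_add_zero_O_ring:
  "\<zero>\<^bsub>O_ring (two_step \<mu>)\<^esub> \<oplus>\<^bsub>O_ring (two_step \<mu>)\<^esub> \<zero>\<^bsub>O_ring (two_step \<mu>)\<^esub> = \<zero>\<^bsub>O_ring (two_step \<mu>)\<^esub>"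
  using O_ring_simps(3)[of 0 0] by (simp add: O_ring_simps)

text \<open>The left factor contributes to the L component only through \<Theta> of its P component.
  This one fact gives both the vanishing cube of O and the vanishing square of the defect.\<close>

lemma mult_eq_zero:
  assumes "u \<in> carrier (O_ring (two_step \<mu>))" and "v \<in> carrier (O_ring (two_step \<mu>))"
    and "Theta \<mu> (fst (O_split u)) = (\<lambda>_. 0)"
  shows "u \<otimes>\<^bsub>O_ring (two_step \<mu>)\<^esub> v = \<zero>\<^bsub>O_ring (two_step \<mu>)\<^esub>"
proof -
  obtain f g where *: "u = J \<hash> f" "v = J \<hash> g" using assms(1,2) by (metis O_ringE)
  have "fst (snd (F_proj (f \<otimes>\<^bsub>F_ring (two_step \<mu>)\<^esub> g))) = 0"
    \<comment> \<open>\<open>Theta_lift_zero\<close> concerns p = 0; rewriting by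
      \<open>Theta_zero\<close> turns it into the case of any p with \<Theta>(p) = 0.\<close>
    using assms(3) Theta_lift_zero[of "fst (F_proj g)"]
    by (simp add: * O_split_coset F_proj_mult Theta_zero zero_prod_def)
  then show ?thesis
    by (simp add: * O_ring_simps J.coset_eq_self_iff mem_J_iff F_proj_mult(1) B.zero_mem)
qed

lemma carrier_mult_add:
  assumes "u \<in> carrier (O_ring (two_step \<mu>))" and "v \<in> carrier (O_ring (two_step \<mu>))"
  shows "u \<otimes>\<^bsub>O_ring (two_step \<mu>)\<^esub> v \<in> carrier (O_ring (two_step \<mu>))"
    and "u \<oplus>\<^bsub>O_ring (two_step \<mu>)\<^esub> v \<in> carrier (O_ring (two_step \<mu>))"
  using assms by (auto elim!: O_ringE simp: O_ring_simps)

lemma O_square_subset: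
  assumes "u \<in> ideal_prod (O_ring (two_step \<mu>)) (carrier (O_ring (two_step \<mu>)))
    (carrier (O_ring (two_step \<mu>)))"
  shows "u \<in> carrier (O_ring (two_step \<mu>)) \<and> fst (O_split u) = 0"
  using assms
proof (induction rule: ideal_prod.induct)
  case (prod u v)
  then show ?case by (simp add: carrier_mult_add O_split_mult)
next
  case (sum u v)
  have "O_split (u \<oplus>\<^bsub>O_ring (two_step \<mu>)\<^esub> v) = O_split u \<otimes>\<^bsub>additive_group \<times>\<times> Q_group \<mu>\<^esub> O_split v"
    using iso_imp_homomorphism[OF O_split_iso] sum.IH by (simp add: hom_def)
  then show ?case using sum.IH by (simp add: carrier_mult_add mult_DirProd')
qed

text \<open>Left factors from the square have P component 0, hence act as zero, and
  \<open>mult_eq_zero\<close> applies.\<close>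

lemma O_cube_eq_zero: "ideal_prod (O_ring (two_step \<mu>))
    (ideal_prod (O_ring (two_step \<mu>)) (carrier (O_ring (two_step \<mu>))) (carrier (O_ring (two_step \<mu>))))
    (carrier (O_ring (two_step \<mu>))) = {\<zero>\<^bsub>O_ring (two_step \<mu>)\<^esub>}"
proof (rule ideal_prod_eq_zero)
  show "ideal_prod (O_ring (two_step \<mu>)) (carrier (O_ring (two_step \<mu>)))
      (carrier (O_ring (two_step \<mu>))) \<noteq> {}"
    using ideal_prod.prod[OF zero_in_O_ring zero_in_O_ring] by blast
qed (use zero_in_O_ring zero_add_zero_O_ring O_square_subset mult_eq_zero Theta_zero in auto)

lemma range_regular_rep:
  "regular_rep (two_step \<mu>) ` carrier (O_ring (two_step \<mu>)) = hom_embed ` range (Theta \<mu>)"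
proof -
  have "fst ` O_split ` carrier (O_ring (two_step \<mu>)) = UNIV"
    using O_split_iso by (auto simp: iso_iff Q_group_simps image_iff)
  then have "hom_embed ` Theta \<mu> ` fst ` O_split ` carrier (O_ring (two_step \<mu>)) =
      hom_embed ` range (Theta \<mu>)" by simp
  then show ?thesis by (simp add: image_image regular_rep_two_step cong: image_cong)
qed

end

section \<open>The unital defect and the regular operator ring\<close>

locale torsion_free_two_step_system = surj_two_step_system \<mu>
  for \<mu> :: "(('e::ab_group_add, 'e) tensor, 'e) tensor \<Rightarrow> 'w::ab_group_add" +
  assumes torsion_free: "\<And>n (w :: 'w). zmul n w = 0 \<Longrightarrow> w \<noteq> 0 \<Longrightarrow> n = 0"
    and nontrivial: "(UNIV :: 'w set) \<noteq> {0}"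
begin

abbreviation "H \<equiv> hom_embed ` range (Theta \<mu>)"

sublocale op: operator_rng H
proof
  fix g h assume g: "g \<in> H" and h: "h \<in> H"
  then obtain p q where *: "g = hom_embed (Theta \<mu> p)" "h = hom_embed (Theta \<mu> q)" by auto
  have "(\<lambda>x. g x - h x) = hom_embed (Theta \<mu> (p - q))"
    by (auto simp: * hom_embed_def Theta_diff)
  then show "(\<lambda>x. g x - h x) \<in> H" by blast
next
  show zero: "(\<lambda>_. 0) \<in> H"
    using hom_embed_eq_zero_iff[of "Theta \<mu> 0"] Theta_zero by (metis image_eqI rangeI)
  fix g h assume "g \<in> H" "h \<in> H"
  then have "g \<circ> h = (\<lambda>_. 0)" using hom_embed_comp by auto
  then show "g \<circ> h \<in> H" using zero by simp
next
  fix n :: int assume "zmul n \<in> H"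
  then obtain p where p: "zmul n = hom_embed (Theta \<mu> p)" by blast
  \<comment> \<open>A nonzero w in W separates the two kinds of operators: the embedded \<Theta>(p)
    kills it, so nw = 0.\<close>
  obtain w :: 'w where "w \<noteq> 0" using nontrivial by blast
  moreover have "zmul n w = 0"
    using fun_cong[OF p, of "(0, w)"] by (simp add: hom_embed_def additive_zero[OF additive_Theta(1)])
  ultimately show "n = 0" by (intro torsion_free)
qed (auto simp: additive_def hom_embed_def additive.add[OF additive_Theta(1)])

lemma unital_regular_rep_eq_op:
  "unital_regular_rep (two_step \<mu>) (n, u) = op.op n (regular_rep (two_step \<mu>) u)"
  by (simp add: unital_regular_rep_def op.op_def)

text \<open>By \<open>range_regular_rep\<close> the image of the unital representation consists
  exactly of the sums of an integer multiple of the identity and an element of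
  \<open>H\<close>.\<close>

lemma regular_operator_ring_eq: "regular_operator_ring (two_step \<mu>) = op.op_ring"
proof -
  have "unital_regular_rep (two_step \<mu>) ` carrier (A_ring (two_step \<mu>)) =
      case_prod op.op ` (UNIV \<times> regular_rep (two_step \<mu>) ` carrier (O_ring (two_step \<mu>)))"
    by (force simp: A_ring_def unitization_def unital_regular_rep_eq_op)
  then show ?thesis
    by (simp add: regular_operator_ring_def op.op_ring_def range_regular_rep)
qed

lemma unital_defect_eq: "unital_defect (two_step \<mu>) = Pair 0 ` intrinsic_defect (two_step \<mu>)"
proof -
  have "op.op n (regular_rep (two_step \<mu>) u) = (\<lambda>_. 0) \<longleftrightarrow> n = 0 \<and> regular_rep (two_step \<mu>) u = (\<lambda>_. 0)"
    if "u \<in> carrier (O_ring (two_step \<mu>))" for n u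
    \<comment> \<open>The zero operator is \<open>op 0\<close> of the zero map, so injectivity
      forces both parts to vanish.\<close>
    using op.op_inject[of "regular_rep (two_step \<mu>) u" "\<lambda>_. 0" n 0] that op.zero_mem
      range_regular_rep op.op_0[of "\<lambda>_. 0"] by auto
  then show ?thesis
    using op.op_0[of "\<lambda>_. 0"]
    by (auto simp: unital_defect_def intrinsic_defect_def a_kernel_def kernel_def A_ring_def
        unitization_def End_ring_def unital_regular_rep_eq_op)
qed

lemma unital_defect_square:
  "ideal_prod (A_ring (two_step \<mu>)) (unital_defect (two_step \<mu>)) (unital_defect (two_step \<mu>)) =
    {\<zero>\<^bsub>A_ring (two_step \<mu>)\<^esub>}"
proof (rule ideal_prod_eq_zero)
  have "O_split \<zero>\<^bsub>O_ring (two_step \<mu>)\<^esub> = (0, range (B_map \<mu>))"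
    using O_split_coset[of 0] by (simp add: O_ring_simps(2) additive_zero[OF additive_F_proj])
  then have "\<zero>\<^bsub>O_ring (two_step \<mu>)\<^esub> \<in> intrinsic_defect (two_step \<mu>)"
    using zero_in_O_ring by (simp add: intrinsic_defect_eq Theta_zero)
  then show ne: "unital_defect (two_step \<mu>) \<noteq> {}" by (auto simp: unital_defect_eq)
  show "x \<otimes>\<^bsub>A_ring (two_step \<mu>)\<^esub> y = \<zero>\<^bsub>A_ring (two_step \<mu>)\<^esub>"
    if xy: "x \<in> unital_defect (two_step \<mu>)" "y \<in> unital_defect (two_step \<mu>)" for x y
  proof -
    obtain u v where x: "x = (0, u)" and y: "y = (0, v)" and u: "u \<in> intrinsic_defect (two_step \<mu>)"
      and v: "v \<in> intrinsic_defect (two_step \<mu>)"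
      using xy unfolding unital_defect_eq by blast
    have "u \<otimes>\<^bsub>O_ring (two_step \<mu>)\<^esub> v = \<zero>\<^bsub>O_ring (two_step \<mu>)\<^esub>"
      using u v by (intro mult_eq_zero) (simp_all add: intrinsic_defect_eq)
    \<comment> \<open>The mixed terms of the unitization product carry the integer 0, and the zeroth
      multiple is the zero of O by definition.\<close>
    moreover have "add_pow (O_ring (two_step \<mu>)) (0 :: int) r = \<zero>\<^bsub>O_ring (two_step \<mu>)\<^esub>" for r
      by (simp add: add_pow_def)
    ultimately show ?thesis
      by (simp add: x y A_ring_def unitization_def zero_add_zero_O_ring)
  qed
  show "unital_defect (two_step \<mu>) \<noteq> {}" by (rule ne)
qed (simp add: A_ring_def unitization_def zero_add_zero_O_ring)

end

section \<open>Assembly of the splitting, the defects and the operator ring\<close>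

theorem theorem11p3:
  fixes \<mu> :: "(('e::ab_group_add, 'e) tensor, 'e) tensor \<Rightarrow> 'w::ab_group_add"
  assumes "free_finite_rank TYPE('e)" and "free_finite_rank TYPE('w)"
    and "(UNIV :: 'e set) \<noteq> {0}" and "(UNIV :: 'w set) \<noteq> {0}"
    and "additive \<mu>" and "surj \<mu>"
  shows
    "(\<exists>\<phi>. \<phi> \<in> iso (add_monoid (O_ring (two_step \<mu>))) (additive_group \<times>\<times> Q_group \<mu>) \<and>
        (\<forall>r\<in>carrier (O_ring (two_step \<mu>)). \<forall>s\<in>carrier (O_ring (two_step \<mu>)).
          \<phi> (r \<otimes>\<^bsub>O_ring (two_step \<mu>)\<^esub> s) = (0, m_bar \<mu> (fst (\<phi> r)) (fst (\<phi> s)))) \<and>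
        \<phi> ` ideal_prod (O_ring (two_step \<mu>)) (carrier (O_ring (two_step \<mu>)))
              (carrier (O_ring (two_step \<mu>)))
          \<subseteq> {0} \<times> carrier (Q_group \<mu>) \<and>
        (\<forall>u\<in>carrier (O_ring (two_step \<mu>)).
          regular_rep (two_step \<mu>) u = hom_embed (Theta \<mu> (fst (\<phi> u)))) \<and>
        \<phi> \<in> iso ((add_monoid (O_ring (two_step \<mu>)))\<lparr>carrier := intrinsic_defect (two_step \<mu>)\<rparr>)
               (additive_group\<lparr>carrier := {p. Theta \<mu> p = (\<lambda>_. 0)}\<rparr> \<times>\<times> Q_group \<mu>)) \<and>
     ideal_prod (O_ring (two_step \<mu>))
         (ideal_prod (O_ring (two_step \<mu>)) (carrier (O_ring (two_step \<mu>)))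
           (carrier (O_ring (two_step \<mu>))))
         (carrier (O_ring (two_step \<mu>)))
       = {\<zero>\<^bsub>O_ring (two_step \<mu>)\<^esub>} \<and>
     unital_defect (two_step \<mu>) = Pair 0 ` intrinsic_defect (two_step \<mu>) \<and>
     ideal_prod (A_ring (two_step \<mu>)) (unital_defect (two_step \<mu>)) (unital_defect (two_step \<mu>))
       = {\<zero>\<^bsub>A_ring (two_step \<mu>)\<^esub>} \<and>
     (\<exists>\<psi>. \<psi> \<in> ring_iso (regular_operator_ring (two_step \<mu>))
              (unitization (End_ring\<lparr>carrier := hom_embed ` range (Theta \<mu>)\<rparr>)) \<and>
        (\<forall>f\<in>hom_embed ` range (Theta \<mu>). \<psi> f = (0, f))) \<and>
     ideal (hom_embed ` range (Theta \<mu>)) (regular_operator_ring (two_step \<mu>)) \<and>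
     ideal_prod (regular_operator_ring (two_step \<mu>))
         (hom_embed ` range (Theta \<mu>)) (hom_embed ` range (Theta \<mu>))
       = {\<zero>\<^bsub>regular_operator_ring (two_step \<mu>)\<^esub>}"
proof -
  interpret torsion_free_two_step_system \<mu>
    by (intro torsion_free_two_step_system.intro surj_two_step_system.intro two_step_system.intro
        surj_two_step_system_axioms.intro torsion_free_two_step_system_axioms.intro assms)
      \<comment> \<open>Freeness of W enters here, as torsion-freeness.\<close>
      (rule free_finite_rank_torsion_free[OF assms(2)])
  have "O_split ` ideal_prod (O_ring (two_step \<mu>)) (carrier (O_ring (two_step \<mu>)))
      (carrier (O_ring (two_step \<mu>))) \<subseteq> {0} \<times> carrier (Q_group \<mu>)"
  proof (rule image_subsetI)
    fix u assume "u \<in> ideal_prod (O_ring (two_step \<mu>)) (carrier (O_ring (two_step \<mu>)))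
      (carrier (O_ring (two_step \<mu>)))"
    from O_square_subset[OF this] show "O_split u \<in> {0} \<times> carrier (Q_group \<mu>)"
      using hom_carrier[OF iso_imp_homomorphism[OF O_split_iso]] by (auto simp: mem_Times_iff)
  qed
  moreover have "ideal_prod op.op_ring H H = {\<zero>\<^bsub>op.op_ring\<^esub>}"
  proof (rule ideal_prod_eq_zero)
    \<comment> \<open>Elements of im \<Theta> compose to zero, since they map into W and kill
      W.\<close>
    fix g h assume "g \<in> H" "h \<in> H"
    then show "g \<otimes>\<^bsub>op.op_ring\<^esub> h = \<zero>\<^bsub>op.op_ring\<^esub>" using hom_embed_comp by auto
  qed simp_all
  ultimately show ?thesis
    unfolding regular_operator_ring_eq
    by (intro conjI exI[of _ O_split] ballI O_split_iso O_split_mult regular_rep_two_step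
        O_split_iso_defect O_cube_eq_zero unital_defect_eq unital_defect_square
        op.op_ring_iso_unitization op.ideal_op_ring)
qed

end
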